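(* Let $m\ge2$ and let $X_1,X_2,\ldots$ be iid random variables with values in the ordered finite alphabet $\{\alpha_1<\cdots<\alpha_m\}$ with $\mathbb{P}(X_1=\alpha_r)=1/m$ for $r=1,\dots,m$. Let $LI_n$ be the length of the longest increasing subsequence of $X_1,\ldots,X_n$. Then, as $n\to\infty$, $$\frac{LI_n-n/m}{\sqrt n}\ \Rightarrow\ \frac{1}{\sqrt m}\ \max_{0=t_0\le t_1\le\cdots\le t_{m-1}\le t_m=1}\ \sum_{i=1}^m\left[\tilde B^i(t_i)-\tilde B^i(t_{i-1})\right],$$ where $(\tilde B^1(t),\tilde B^2(t),\dots,\tilde B^m(t))$, $0\le t\le1$, is an $m$-dimensional Brownian motion with covariance matrix $\frac{m-1}{m}\,tM$, where $M$ is the $m\times m$ matrix with all diagonal entries equal to $1$ and all off-diagonal entries equal to $\rho=-1/(m-1)$; that is, $\operatorname{Var}\tilde B^i(t)=\frac{m-1}{m}t$ and $\operatorname{Cov}(\tilde B^i(t),\tilde B^j(t))=-\frac{t}{m}$ for $i\ne j$. (This Brownian motion satisfies $\sum_{i=1}^m\tilde B^i(t)=0$ for all $0\le t\le 1$.)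
   Context: Increasing subsequences are understood in the weak (nondecreasing) sense: $LI_n$ is the largest $\ell$ for which there are indices $1\le i_1<\cdots<i_\ell\le n$ with $X_{i_1}\le\cdots\le X_{i_\ell}$. The symbol $\Rightarrow$ denotes convergence in distribution. A $d$-dimensional Brownian motion is a linear transformation of a standard multidimensional Brownian motion on $[0,1]$ started at $0$; saying it has covariance matrix $tM$ means that it is a centered Gaussian process with continuous paths and stationary independent increments whose value at time $t$ has covariance matrix $tM$. *)

theory Defs
  imports "HOL-Probability.Probability"
begin

definition longest_increasing :: "(nat \<Rightarrow> 'c::linorder) \<Rightarrow> nat \<Rightarrow> nat" where
  "longest_increasing x n =
     Max {l. \<exists>i. i ` {1..l} \<subseteq> {1..n} \<and> strict_mono_on {1..l} i \<and> mono_on {1..l} (\<lambda>k. x (i k))}"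

definition covariance :: "'b measure \<Rightarrow> ('b \<Rightarrow> real) \<Rightarrow> ('b \<Rightarrow> real) \<Rightarrow> real" where
  "covariance N Y Z = (\<integral>\<omega>. (Y \<omega> - (\<integral>\<omega>. Y \<omega> \<partial>N)) * (Z \<omega> - (\<integral>\<omega>. Z \<omega> \<partial>N)) \<partial>N)"

(* Constants count as (degenerate) Gaussian variables; this is needed because covariance
   matrices may be singular. *)
definition gaussian_rv :: "'b measure \<Rightarrow> ('b \<Rightarrow> real) \<Rightarrow> bool" where
  "gaussian_rv N Z \<longleftrightarrow> Z \<in> borel_measurable N \<and>
     ((\<exists>\<mu>. AE \<omega> in N. Z \<omega> = \<mu>) \<or>
      (\<exists>\<mu> \<sigma>. \<sigma> > 0 \<and> distributed N lborel Z (normal_density \<mu> \<sigma>)))"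

definition gaussian_process :: "'b measure \<Rightarrow> 'i set \<Rightarrow> ('i \<Rightarrow> 'b \<Rightarrow> real) \<Rightarrow> bool" where
  "gaussian_process N I Z \<longleftrightarrow>
     (\<forall>J c. finite J \<and> J \<subseteq> I \<longrightarrow> gaussian_rv N (\<lambda>\<omega>. \<Sum>j\<in>J. c j * Z j \<omega>))"

definition increment ::
    "nat \<Rightarrow> (nat \<Rightarrow> real \<Rightarrow> 'b \<Rightarrow> real) \<Rightarrow> real \<Rightarrow> real \<Rightarrow> 'b \<Rightarrow> nat \<Rightarrow> real" where
  "increment d B s t \<omega> = (\<lambda>i\<in>{1..d}. B i t \<omega> - B i s \<omega>)"

(* B i t is the i-th coordinate (i = 1..d) at time t in [0,1]; values of B outside this
   index range are irrelevant. *)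
definition brownian_motion ::
    "'b measure \<Rightarrow> nat \<Rightarrow> (nat \<Rightarrow> nat \<Rightarrow> real) \<Rightarrow> (nat \<Rightarrow> real \<Rightarrow> 'b \<Rightarrow> real) \<Rightarrow> bool" where
  "brownian_motion N d C B \<longleftrightarrow>
     prob_space N \<and>
     gaussian_process N ({1..d} \<times> {0..1}) (\<lambda>(i, t). B i t) \<and>
     (\<forall>i\<in>{1..d}. \<forall>t\<in>{0..1}. (\<integral>\<omega>. B i t \<omega> \<partial>N) = 0) \<and>
     (\<forall>i\<in>{1..d}. AE \<omega> in N. B i 0 \<omega> = 0) \<and>
     (\<forall>\<omega>\<in>space N. \<forall>i\<in>{1..d}. continuous_on {0..1} (\<lambda>t. B i t \<omega>)) \<and>
     (\<forall>s t. 0 \<le> s \<and> s \<le> t \<and> t \<le> 1 \<longrightarrow>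
        distr N (\<Pi>\<^sub>M i\<in>{1..d}. borel) (increment d B s t) =
        distr N (\<Pi>\<^sub>M i\<in>{1..d}. borel) (increment d B 0 (t - s))) \<and>
     (\<forall>(k::nat) t. mono_on {0..k} t \<and> 0 \<le> t 0 \<and> t k \<le> 1 \<longrightarrow>
        prob_space.indep_vars N (\<lambda>_. \<Pi>\<^sub>M i\<in>{1..d}. borel)
          (\<lambda>j. increment d B (t (j - 1)) (t j)) {1..k}) \<and>
     (\<forall>t\<in>{0..1}. \<forall>i\<in>{1..d}. \<forall>j\<in>{1..d}. covariance N (B i t) (B j t) = t * C i j)"

definition chains :: "nat \<Rightarrow> (nat \<Rightarrow> real) set" where
  "chains m = {t. t 0 = 0 \<and> t m = 1 \<and> (\<forall>i\<in>{1..m}. t (i - 1) \<le> t i)}"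

(* GREATEST denotes the maximum of the set of values, when it exists; for continuous paths
   it does, by chain_max_attained below. *)
definition chain_max :: "nat \<Rightarrow> (nat \<Rightarrow> real \<Rightarrow> real) \<Rightarrow> real" where
  "chain_max m b =
     (GREATEST v. v \<in> (\<lambda>t. \<Sum>i=1..m. b i (t i) - b i (t (i - 1))) ` chains m)"

lemma chains_bounds:
  assumes "t \<in> chains m" "i \<le> m"
  shows "t i \<in> {0..1}"
proof -
  have step: "t j \<le> t (Suc j)" if "j < m" for j
    using assms(1) that by (force simp: chains_def dest: bspec[where x="Suc j"])
  have le: "t j \<le> t k" if "j \<le> k" "k \<le> m" for j k
    using that
  proof (induction k rule: dec_induct)
    case (step n)
    then show ?case using \<open>\<And>j. j < m \<Longrightarrow> t j \<le> t (Suc j)\<close>[of n] by simp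
  qed simp
  show ?thesis
    using le[of 0 i] le[of i m] assms by (auto simp: chains_def)
qed

lemma chain_max_attained:
  assumes m: "m \<ge> 1"
    and cont: "\<And>i. i \<in> {1..m} \<Longrightarrow> continuous_on {0..1} (b i)"
  shows "\<exists>t\<in>chains m. chain_max m b = (\<Sum>i=1..m. b i (t i) - b i (t (i - 1))) \<and>
    (\<forall>s\<in>chains m. (\<Sum>i=1..m. b i (s i) - b i (s (i - 1))) \<le> chain_max m b)"
proof -
  define f where "f t = (\<Sum>i=1..m. b i (t i) - b i (t (i - 1)))" for t :: "nat \<Rightarrow> real"
  define P where "P = (Pi UNIV (\<lambda>_. {0..1}) :: (nat \<Rightarrow> real) set)"
  define K where "K = P \<inter> chains m"
  have "compactin (product_topology (\<lambda>_. euclidean) UNIV) (PiE (UNIV :: nat set) (\<lambda>_. {0..1::real}))"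
    by (subst compactin_PiE) auto
  then have "compact P"
    by (simp add: P_def PiE_UNIV_domain euclidean_product_topology)
  moreover have "closed (chains m)"
  proof -
    have "chains m = {t. t 0 = 0} \<inter> {t. t m = 1} \<inter> (\<Inter>i\<in>{1..m}. {t. t (i - 1) \<le> t i})"
      by (auto simp: chains_def)
    then show ?thesis
      by (simp only:) (intro closed_Int closed_INT closed_Collect_eq closed_Collect_le ballI
          continuous_on_product_coordinates continuous_on_const)
  qed
  ultimately have "compact K"
    unfolding K_def by (rule compact_Int_closed)
  have "(\<lambda>i. if i = 0 then 0 else 1) \<in> K"
    using m by (auto simp: K_def P_def chains_def)
  then have "K \<noteq> {}" by blast
  have c: "continuous_on K (\<lambda>t. b i (t j))" if "i \<in> {1..m}" for i j
    by (rule continuous_on_compose2[OF cont[OF that]])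
       (auto simp: K_def P_def intro: continuous_on_subset[OF continuous_on_product_coordinates])
  have "continuous_on K f"
    unfolding f_def by (intro continuous_intros c) auto
  then obtain t where t: "t \<in> K" "\<And>s. s \<in> K \<Longrightarrow> f s \<le> f t"
    using continuous_attains_sup[OF \<open>compact K\<close> \<open>K \<noteq> {}\<close>] by blast
  have max: "f s \<le> f t" if s: "s \<in> chains m" for s
  proof -
    let ?s = "\<lambda>i. if i \<le> m then s i else 0"
    have "?s \<in> K"
      using s chains_bounds[OF s] by (auto simp: K_def P_def chains_def)
    moreover have "f ?s = f s"
      unfolding f_def by (intro sum.cong) auto
    ultimately show ?thesis using t(2) by force
  qed
  have "chain_max m b = f t"
    unfolding chain_max_def f_def[symmetric]
    by (rule Greatest_equality) (use t max in \<open>auto simp: K_def\<close>)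
  then show ?thesis
    using t(1) max unfolding f_def K_def by auto
qed

end

theory Submission
  imports Defs "HOL-Real_Asymp.Real_Asymp"
begin

text \<open>
  Why the limit is a Brownian last-passage functional. Cut a word of length \<open>n\<close> at positions
  \<open>0 = c 0 \<le> c 1 \<le> \<dots> \<le> c m = n\<close> and keep from the \<open>r\<close>-th block only the letters
  \<open>\<alpha> r\<close>: what is kept is increasing, and every increasing subsequence sits inside one obtained in
  this way. So \<open>LI n\<close> is a maximum over cuts of sums of letter indicators
  (\<open>longest_increasing_eq_passage_max\<close>). Every cut collects exactly \<open>n\<close> indicators, one per position,
  so centring each of them at its mean \<open>1/m\<close> shifts the maximum by exactly \<open>n/m\<close>, and the normalised
  \<open>LI n\<close> is the same maximum for the centred vectors
  \<open>U k r = (of_bool (X k = \<alpha> r) - 1/m) / sqrt n\<close>. On the other side, evaluating the Brownian functional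
  only at times that are multiples of \<open>1/n\<close> gives the same maximum for the vectors of scaled Brownian
  increments \<open>V k\<close>, and by continuity of the paths it converges to the full functional
  (\<open>passage_max_path_tendsto\<close>). Both families are iid over \<open>k\<close>, centred, with the same covariance
  matrix and with third absolute moments of order \<open>n powr (-3/2)\<close>.

  It remains to see that the law of the maximum depends asymptotically on two moments only. This is
  done by Lindeberg's exchange argument directly on the path space, which avoids both a multivariate
  central limit theorem and a tightness proof. With the partition function
  \<open>Z = (\<Sum>c. exp (\<beta> * S c))\<close>, where \<open>S c\<close> is the sum along the cut \<open>c\<close>, the random variable
  \<open>exp (- exp (- \<beta> x) * Z)\<close> is a smooth proxy for the indicator of \<open>max S \<le> x\<close>: it is close to \<open>1\<close> if
  \<open>max S\<close> lies clearly below \<open>x\<close> and close to \<open>0\<close> if it lies clearly above, as soon as \<open>\<beta>\<close> beats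
  the logarithm of the number of cuts, which is of order \<open>m * ln n\<close>. Its third derivative in one
  vector is of order \<open>\<beta> ^ 3\<close> (\<open>gumbel_third_order_bound\<close>), so exchanging one vector costs
  \<open>O(\<beta> ^ 3 * n powr (-3/2))\<close> and exchanging all \<open>n\<close> of them costs \<open>O(\<beta> ^ 3 / sqrt n)\<close>
  (\<open>partition_fun_universality\<close>). The choice \<open>\<beta> = n powr (1/12)\<close> meets both requirements, and
  \<open>weak_conv_m_by_soft_indicators\<close> turns the statement about proxies into convergence in distribution.

  The coordinates of the Brownian motion sum to zero because the entries of the covariance matrix
  do: the sum has variance zero at each fixed time, and continuity passes from the countably many
  times \<open>k/n\<close> to all times (\<open>brownian_motion_sum_zero\<close>).
\<close>

section \<open>The Lindeberg exchange argument\<close>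

text \<open>A Taylor expansion of order two of \<open>t \<mapsto> exp (- A t)\<close> with \<open>A t = (\<Sum>c\<in>C. w c * exp (t * l c))\<close>, from
  \<open>0\<close> to \<open>1\<close>. The remainder is bounded independently of the weights \<open>w\<close>: each
  derivative of \<open>A\<close> costs a factor \<open>a\<close> and reproduces \<open>A\<close>, and powers of \<open>A\<close> are absorbed by
  \<open>exp (- A)\<close>.\<close>
lemma gumbel_third_order_bound:
  fixes w l :: "'c \<Rightarrow> real"
  assumes w: "\<And>c. c \<in> C \<Longrightarrow> w c \<ge> 0" and l: "\<And>c. c \<in> C \<Longrightarrow> \<bar>l c\<bar> \<le> a" and a: "a \<ge> 0"
  shows "\<bar>exp (- (\<Sum>c\<in>C. w c * exp (l c)))
      - exp (- (\<Sum>c\<in>C. w c)) * (1 - (\<Sum>c\<in>C. w c * l c)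
          + ((\<Sum>c\<in>C. w c * l c)\<^sup>2 - (\<Sum>c\<in>C. w c * (l c)\<^sup>2)) / 2)\<bar> \<le> 9/2 * a ^ 3"
proof -
  define A where "A j s = (\<Sum>c\<in>C. w c * l c ^ j * exp (s * l c))" for j :: nat and s :: real
  have dA [derivative_intros]: "(A j has_real_derivative A (Suc j) s) (at s)" for j s
    unfolding A_def by (auto intro!: derivative_eq_intros sum.cong simp: ac_simps)
  \<comment> \<open>\<open>d j\<close> is the \<open>j\<close>-th derivative of \<open>exp (- A 0 s)\<close>, for \<open>j \<le> 3\<close>.\<close>
  define d where "d j s = (if j = 0 then 1 else if j = 1 then - A 1 s else if j = 2 then (A 1 s)\<^sup>2 - A 2 s
       else - ((A 1 s) ^ 3) + 3 * A 1 s * A 2 s - A 3 s) * exp (- A 0 s)" for j :: nat and s :: real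
  have dd: "(d j has_real_derivative d (Suc j) s) (at s)" if "j < 3" for j s
  proof -
    consider "j = 0" | "j = 1" | "j = 2" using \<open>j < 3\<close> by linarith
    then show ?thesis
      by cases (auto simp: d_def[abs_def] fun_eq_iff eval_nat_numeral field_simps
            intro!: derivative_eq_intros)
  qed
  obtain t where t: "0 < t" "t < 1"
    "d 0 1 = (\<Sum>j<3. (d j 0 / fact j) * 1 ^ j) + (d 3 t / fact 3) * 1 ^ 3"
    using Maclaurin[of 1 3 d "d 0"] dd by auto
  have A0: "A 0 t \<ge> 0"
    unfolding A_def by (intro sum_nonneg) (use w in auto)
  have Aj: "\<bar>A j t\<bar> \<le> a ^ j * A 0 t" for j
  proof -
    have "\<bar>A j t\<bar> \<le> (\<Sum>c\<in>C. \<bar>w c * l c ^ j * exp (t * l c)\<bar>)"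
      unfolding A_def by (rule sum_abs)
    also have "\<dots> \<le> (\<Sum>c\<in>C. a ^ j * (w c * exp (t * l c)))"
    proof (rule sum_mono)
      fix c assume c: "c \<in> C"
      have "\<bar>l c\<bar> ^ j \<le> a ^ j" using l[OF c] by (intro power_mono) auto
      then have "\<bar>l c\<bar> ^ j * (w c * exp (t * l c)) \<le> a ^ j * (w c * exp (t * l c))"
        using w[OF c] by (intro mult_right_mono) auto
      then show "\<bar>w c * l c ^ j * exp (t * l c)\<bar> \<le> a ^ j * (w c * exp (t * l c))"
        using w[OF c] by (simp add: abs_mult power_abs ac_simps)
    qed
    also have "\<dots> = a ^ j * A 0 t"
      by (simp add: A_def sum_distrib_left)
    finally show ?thesis .
  qed
  define x where "x = A 0 t"
  have "\<bar>- ((A 1 t) ^ 3) + 3 * A 1 t * A 2 t - A 3 t\<bar> \<le> \<bar>A 1 t\<bar> ^ 3 + 3 * (\<bar>A 1 t\<bar> * \<bar>A 2 t\<bar>) + \<bar>A 3 t\<bar>"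
    unfolding power_abs[symmetric] abs_mult[symmetric] by linarith
  also have "\<dots> \<le> (a ^ 1 * x) ^ 3 + 3 * ((a ^ 1 * x) * (a ^ 2 * x)) + a ^ 3 * x"
    unfolding x_def using Aj[of 1] Aj[of 2] Aj[of 3] A0 a
    by (intro add_mono power_mono mult_mono mult_nonneg_nonneg) auto
  also have "\<dots> = a ^ 3 * (x ^ 3 + 3 * x\<^sup>2 + x)"
    by (simp add: algebra_simps power2_eq_square power3_eq_cube)
  \<comment> \<open>\<open>x ^ 3 + 3 * x\<^sup>2 + x \<le> (x + 1) ^ 3\<close>, and the cube is absorbed by writing \<open>exp x\<close> as a cube.\<close>
  also have "\<dots> \<le> a ^ 3 * (27 * exp x)"
  proof (intro mult_left_mono)
    have "x ^ 3 + 3 * x\<^sup>2 + x \<le> (x + 1) ^ 3"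
      using A0 unfolding x_def by (simp add: power2_eq_square power3_eq_cube algebra_simps)
    also have "\<dots> = 27 * ((x + 1) / 3) ^ 3" by (simp add: power_divide)
    also have "\<dots> \<le> 27 * exp (x / 3) ^ 3"
    proof (intro mult_left_mono power_mono)
      show "(x + 1) / 3 \<le> exp (x / 3)"
        by (rule order_trans[OF _ exp_ge_add_one_self]) (simp add: field_simps)
    qed (use A0 in \<open>auto simp: x_def\<close>)
    also have "exp (x / 3) ^ 3 = exp x"
      by (simp flip: exp_of_nat_mult)
    finally show "x ^ 3 + 3 * x\<^sup>2 + x \<le> 27 * exp x" .
  qed (use a in auto)
  finally have "\<bar>- ((A 1 t) ^ 3) + 3 * A 1 t * A 2 t - A 3 t\<bar> * exp (- x) \<le> a ^ 3 * (27 * exp x) * exp (- x)"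
    by (intro mult_right_mono) auto
  then have d3: "\<bar>d 3 t\<bar> \<le> 27 * a ^ 3"
    by (simp add: d_def abs_mult x_def[symmetric] exp_minus field_simps)
  have "d 0 1 - (d 0 0 + d 1 0 + d 2 0 / 2) = d 3 t / 6"
    using t(3) by (simp add: eval_nat_numeral)
  then have "\<bar>d 0 1 - (d 0 0 + d 1 0 + d 2 0 / 2)\<bar> \<le> 9/2 * a ^ 3"
    using d3 by linarith
  moreover have "d 0 0 + d 1 0 + d 2 0 / 2 = exp (- (\<Sum>c\<in>C. w c)) * (1 - (\<Sum>c\<in>C. w c * l c)
          + ((\<Sum>c\<in>C. w c * l c)\<^sup>2 - (\<Sum>c\<in>C. w c * (l c)\<^sup>2)) / 2)"
    by (simp add: d_def A_def field_simps)
  moreover have "d 0 1 = exp (- (\<Sum>c\<in>C. w c * exp (l c)))"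
    by (simp add: d_def A_def)
  ultimately show ?thesis by simp
qed

text \<open>Laws on \<open>\<real>\<^sup>m\<close>, realised as functions on \<open>{1..m}\<close>, that the exchange argument cannot tell apart:
  mean zero, prescribed second moments \<open>C\<close>, and third moments controlled by \<open>\<tau>\<close>.
  Third moments make all lower ones finite, so integrability is required only there.\<close>
definition centered_vector_law ::
    "nat \<Rightarrow> (nat \<Rightarrow> nat \<Rightarrow> real) \<Rightarrow> real \<Rightarrow> (nat \<Rightarrow> real) measure \<Rightarrow> bool" where
  "centered_vector_law m C \<tau> P \<longleftrightarrow>
     prob_space P \<and> sets P = sets (\<Pi>\<^sub>M r\<in>{1..m}. borel) \<and>
     (\<forall>r\<in>{1..m}. integrable P (\<lambda>y. \<bar>y r\<bar> ^ 3) \<and> (\<integral>y. \<bar>y r\<bar> ^ 3 \<partial>P) \<le> \<tau> \<and> (\<integral>y. y r \<partial>P) = 0) \<and>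
     (\<forall>r\<in>{1..m}. \<forall>s\<in>{1..m}. (\<integral>y. y r * y s \<partial>P) = C r s)"

lemma sum_cube_le:
  fixes y :: "nat \<Rightarrow> real"
  shows "(\<Sum>r\<in>{1..m}. \<bar>y r\<bar>) ^ 3 \<le> real m ^ 3 * (\<Sum>r\<in>{1..m}. \<bar>y r\<bar> ^ 3)"
proof (cases "m = 0")
  case False
  define a where "a = Max ((\<lambda>r. \<bar>y r\<bar>) ` {1..m})"
  have a_ge: "\<bar>y r\<bar> \<le> a" if "r \<in> {1..m}" for r
    unfolding a_def using that by (intro Max_ge) auto
  have "a \<in> (\<lambda>r. \<bar>y r\<bar>) ` {1..m}"
    unfolding a_def using False by (intro Max_in) auto
  then obtain r where r: "r \<in> {1..m}" "a = \<bar>y r\<bar>" by auto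
  have "(\<Sum>r\<in>{1..m}. \<bar>y r\<bar>) ^ 3 \<le> (real m * a) ^ 3"
    using sum_bounded_above[of "{1..m}" "\<lambda>r. \<bar>y r\<bar>" a] a_ge by (intro power_mono sum_nonneg) auto
  also have "\<dots> = real m ^ 3 * \<bar>y r\<bar> ^ 3" by (simp add: r power_mult_distrib)
  also have "\<dots> \<le> real m ^ 3 * (\<Sum>r\<in>{1..m}. \<bar>y r\<bar> ^ 3)"
    by (intro mult_left_mono member_le_sum[OF r(1)]) auto
  finally show ?thesis .
qed simp

text \<open>The second-order Taylor polynomial of the integrand is a polynomial of degree two in \<open>y\<close>, so its
  expectation \<open>T'\<close> is determined by the first two moments, which \<open>P\<close> and \<open>Q\<close> share. Only the
  remainder is left, and it is a third moment.\<close>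
lemma centered_vector_law_exchange:
  fixes w :: "'c \<Rightarrow> real" and b :: "'c \<Rightarrow> nat \<Rightarrow> real"
  assumes P: "centered_vector_law m C \<tau> P" and Q: "centered_vector_law m C \<tau> Q"
    and J: "finite J" and w: "\<And>c. c \<in> J \<Longrightarrow> w c \<ge> 0" 
    and b: "\<And>c r. c \<in> J \<Longrightarrow> r \<in> {1..m} \<Longrightarrow> \<bar>b c r\<bar> \<le> \<beta>" and \<beta>: "\<beta> \<ge> 0"
  defines "h \<equiv> \<lambda>y. exp (- (\<Sum>c\<in>J. w c * exp (\<Sum>r=1..m. b c r * y r)))"
  shows "\<bar>(\<integral>y. h y \<partial>P) - (\<integral>y. h y \<partial>Q)\<bar> \<le> 9 * real m ^ 4 * \<beta> ^ 3 * \<tau>"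
proof -
  define L where "L c y = (\<Sum>r=1..m. b c r * y r)" for c and y :: "nat \<Rightarrow> real"
  define T where "T y = exp (- (\<Sum>c\<in>J. w c)) * (1 - (\<Sum>c\<in>J. w c * L c y)
          + ((\<Sum>c\<in>J. \<Sum>d\<in>J. w c * w d * (L c y * L d y)) - (\<Sum>c\<in>J. w c * (L c y * L c y))) / 2)" for y
  define T' where "T' = exp (- (\<Sum>c\<in>J. w c)) * (1 - 0
          + ((\<Sum>c\<in>J. \<Sum>d\<in>J. w c * w d * (\<Sum>r=1..m. \<Sum>s=1..m. b c r * b d s * C r s)) 
            - (\<Sum>c\<in>J. w c * (\<Sum>r=1..m. \<Sum>s=1..m. b c r * b c s * C r s))) / 2)"
  have pointwise: "\<bar>h y - T y\<bar> \<le> 9/2 * \<beta> ^ 3 * real m ^ 3 * (\<Sum>r\<in>{1..m}. \<bar>y r\<bar> ^ 3)" for y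
  proof -
    have Lb: "\<bar>L c y\<bar> \<le> \<beta> * (\<Sum>r=1..m. \<bar>y r\<bar>)" if "c \<in> J" for c
      unfolding L_def sum_distrib_left using b[OF that]
      by (intro order_trans[OF sum_abs] sum_mono) (auto simp: abs_mult intro!: mult_right_mono)
    have hL: "h y = exp (- (\<Sum>c\<in>J. w c * exp (L c y)))"
      by (simp add: h_def L_def)
    have "\<bar>h y - T y\<bar> \<le> 9/2 * (\<beta> * (\<Sum>r=1..m. \<bar>y r\<bar>)) ^ 3"
      using gumbel_third_order_bound[of J w "\<lambda>c. L c y", OF w Lb] \<beta>
      by (simp add: hL T_def power2_eq_square sum_product mult.assoc mult.left_commute sum_nonneg)
    also have "\<dots> = 9/2 * \<beta> ^ 3 * (\<Sum>r=1..m. \<bar>y r\<bar>) ^ 3" by (simp add: power_mult_distrib)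
    also have "\<dots> \<le> 9/2 * \<beta> ^ 3 * (real m ^ 3 * (\<Sum>r\<in>{1..m}. \<bar>y r\<bar> ^ 3))"
      using \<beta> by (intro mult_left_mono sum_cube_le) auto
    finally show ?thesis by simp
  qed
  have main: "\<bar>(\<integral>y. h y \<partial>R) - T'\<bar> \<le> 9/2 * real m ^ 4 * \<beta> ^ 3 * \<tau>"
    if R: "centered_vector_law m C \<tau> R" for R
  proof -
    interpret R: prob_space R using R by (simp add: centered_vector_law_def)
    have [measurable_cong]: "sets R = sets (\<Pi>\<^sub>M r\<in>{1..m}. borel)" 
      using R by (simp add: centered_vector_law_def)
    have i3: "integrable R (\<lambda>y. \<bar>y r\<bar> ^ 3)" if "r \<in> {1..m}" for r
      using R that by (simp add: centered_vector_law_def)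
    have meas[measurable]: "(\<lambda>y. y r) \<in> borel_measurable R" if "r \<in> {1..m}" for r
      using that by measurable
    have cube: "x ^ 2 \<le> 1 + \<bar>x\<bar> ^ 3" "\<bar>x\<bar> \<le> 1 + \<bar>x\<bar> ^ 3" for x :: real
    proof -
      have "\<bar>x\<bar> ^ j \<le> 1 + \<bar>x\<bar> ^ 3" if "j \<le> 3" for j
        using power_increasing[OF that, of "\<bar>x\<bar>"] power_le_one[of "\<bar>x\<bar>" j]
        by (cases "\<bar>x\<bar> \<ge> 1") (auto intro: add_increasing2)
      from this[of 2] this[of 1] show "x ^ 2 \<le> 1 + \<bar>x\<bar> ^ 3" "\<bar>x\<bar> \<le> 1 + \<bar>x\<bar> ^ 3" by auto
    qed
    have i1: "integrable R (\<lambda>y. y r)" if "r \<in> {1..m}" for r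
      by (rule Bochner_Integration.integrable_bound[of _ "\<lambda>y. 1 + \<bar>y r\<bar> ^ 3"])
        (use that i3[OF that] cube(2) in \<open>auto intro!: AE_I2\<close>)
    have i2: "integrable R (\<lambda>y. y r * y s)" if "r \<in> {1..m}" "s \<in> {1..m}" for r s
    proof (rule Bochner_Integration.integrable_bound[of _ "\<lambda>y. (1 + \<bar>y r\<bar> ^ 3) + (1 + \<bar>y s\<bar> ^ 3)"])
      have "\<bar>u * v\<bar> \<le> \<bar>(1 + \<bar>u\<bar> ^ 3) + (1 + \<bar>v\<bar> ^ 3)\<bar>" for u v :: real
      proof -
        have "\<bar>u * v\<bar> \<le> u\<^sup>2 + v\<^sup>2"
          using sum_squares_bound[of "\<bar>u\<bar>" "\<bar>v\<bar>"] abs_ge_zero[of "u * v"]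
          unfolding abs_mult power2_abs by linarith
        then show ?thesis using cube(1)[of u] cube(1)[of v] by linarith
      qed
      then show "AE y in R. norm (y r * y s) \<le> norm ((1 + \<bar>y r\<bar> ^ 3) + (1 + \<bar>y s\<bar> ^ 3))"
        by (intro AE_I2) (simp only: real_norm_def)
    qed (use that i3 in auto)
    have LL: "has_bochner_integral R (\<lambda>y. L c y * L d y) (\<Sum>r=1..m. \<Sum>s=1..m. b c r * b d s * C r s)" for c d
    proof -
      have "has_bochner_integral R (\<lambda>y. \<Sum>r=1..m. \<Sum>s=1..m. b c r * b d s * (y r * y s)) (\<Sum>r=1..m. \<Sum>s=1..m. b c r * b d s * C r s)"
        using i2 R
        by (intro has_bochner_integral_sum has_bochner_integral_mult_right)
          (auto simp: has_bochner_integral_iff centered_vector_law_def)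
      then show ?thesis by (simp add: L_def sum_product ac_simps)
    qed
    have L1: "has_bochner_integral R (L c) 0" for c
    proof -
      have "has_bochner_integral R (\<lambda>y. \<Sum>r=1..m. b c r * y r) (\<Sum>r=1..m. b c r * 0)"
        using i1 R
        by (intro has_bochner_integral_sum has_bochner_integral_mult_right)
          (auto simp: has_bochner_integral_iff centered_vector_law_def)
      then show ?thesis by (simp add: L_def[abs_def])
    qed
    have one: "has_bochner_integral R (\<lambda>y. 1 :: real) 1"
      using R.prob_space by (simp add: has_bochner_integral_iff)
    have "has_bochner_integral R (\<lambda>y. \<Sum>c\<in>J. w c * L c y) (\<Sum>c\<in>J. w c * 0)"
      by (intro has_bochner_integral_sum has_bochner_integral_mult_right L1)
    then have sL: "has_bochner_integral R (\<lambda>y. \<Sum>c\<in>J. w c * L c y) 0" by simp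
    have T: "has_bochner_integral R T T'"
      unfolding T_def[abs_def] T'_def
      by (intro has_bochner_integral_mult_right has_bochner_integral_add has_bochner_integral_diff
           has_bochner_integral_divide_zero has_bochner_integral_sum one sL LL)
    have hm: "h \<in> borel_measurable R"
      unfolding h_def by measurable
    have hi: "integrable R h"
      by (rule R.integrable_const_bound[of _ 1]) (use hm w in \<open>auto simp: h_def intro!: sum_nonneg AE_I2\<close>)
    have i3': "integrable R (\<lambda>y. 9/2 * \<beta> ^ 3 * real m ^ 3 * (\<Sum>r\<in>{1..m}. \<bar>y r\<bar> ^ 3))"
      by (intro integrable_mult_right Bochner_Integration.integrable_sum i3)
    have "\<bar>(\<integral>y. h y \<partial>R) - T'\<bar> = \<bar>\<integral>y. h y - T y \<partial>R\<bar>"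
      using T hi by (simp add: has_bochner_integral_iff)
    also have "\<dots> \<le> (\<integral>y. 9/2 * \<beta> ^ 3 * real m ^ 3 * (\<Sum>r\<in>{1..m}. \<bar>y r\<bar> ^ 3) \<partial>R)"
      using T hi
      by (intro order_trans[OF integral_abs_bound] integral_mono pointwise i3')
        (auto simp: has_bochner_integral_iff)
    also have "\<dots> = 9/2 * \<beta> ^ 3 * real m ^ 3 * (\<Sum>r\<in>{1..m}. \<integral>y. \<bar>y r\<bar> ^ 3 \<partial>R)"
      using i3 by simp
    also have "\<dots> \<le> 9/2 * \<beta> ^ 3 * real m ^ 3 * (\<Sum>r\<in>{1..m}. \<tau>)"
      using R \<beta> by (intro mult_left_mono sum_mono) (auto simp: centered_vector_law_def)
    also have "\<dots> = 9/2 * real m ^ 4 * \<beta> ^ 3 * \<tau>"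
      by (simp add: eval_nat_numeral)
    finally show ?thesis .
  qed
  show ?thesis using main[OF P] main[OF Q] by linarith
qed

text \<open>The factors \<open>P k\<close> are replaced by \<open>Q k\<close> one after the other. All intermediate hybrid measures
  agree outside the factor that is being replaced, so by Fubini each step is an average over the
  other coordinates of one-coordinate differences.\<close>
lemma product_measure_exchange:
  fixes f :: "('i \<Rightarrow> 'b) \<Rightarrow> real"
  assumes I: "finite I" 
    and P: "\<And>k. prob_space (P k)" and Q: "\<And>k. prob_space (Q k)"
    and PS: "\<And>k. sets (P k) = sets S" and QS: "\<And>k. sets (Q k) = sets S"
    and f: "f \<in> borel_measurable (\<Pi>\<^sub>M k\<in>I. S)" and fb: "\<And>x. \<bar>f x\<bar> \<le> K"
    and exch: "\<And>k x. k \<in> I \<Longrightarrow> \<bar>(\<integral>y. f (x(k := y)) \<partial>P k) - (\<integral>y. f (x(k := y)) \<partial>Q k)\<bar> \<le> e"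
  shows "\<bar>(\<integral>x. f x \<partial>(\<Pi>\<^sub>M k\<in>I. P k)) - (\<integral>x. f x \<partial>(\<Pi>\<^sub>M k\<in>I. Q k))\<bar> \<le> real (card I) * e"
proof -
  define R where "R J = (\<lambda>k. if k \<in> J then Q k else P k)" for J
  have R_prob: "prob_space (R J k)" for J k using P Q by (simp add: R_def)
  have R_sets: "sets (R J k) = sets S" for J k using PS QS by (simp add: R_def)
  have "\<bar>(\<integral>x. f x \<partial>(\<Pi>\<^sub>M k\<in>I. P k)) - (\<integral>x. f x \<partial>(\<Pi>\<^sub>M i\<in>I. R J i))\<bar> \<le> real (card J) * e"
    if "finite J" "J \<subseteq> I" for J
    using that
  proof (induction J rule: finite_induct)
    case empty
    then show ?case by (simp add: R_def)
  next
    case (insert k J)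
    define I' where "I' = I - {k}"
    have II: "I = insert k I'" "k \<notin> I'" "finite I'" using insert.prems I by (auto simp: I'_def)
    have slice: "(\<integral>x. f x \<partial>(\<Pi>\<^sub>M i\<in>I. R J i)) = (\<integral>x. (\<integral>y. f (x(k := y)) \<partial>R J k) \<partial>(\<Pi>\<^sub>M i\<in>I'. R J i))"
      and fub: "integrable (\<Pi>\<^sub>M i\<in>I'. R J i) (\<lambda>x. \<integral>y. f (x(k := y)) \<partial>R J k)" for J
    proof -
      interpret product_sigma_finite "R J"
        by (simp add: product_sigma_finite_def prob_space_imp_sigma_finite R_prob)
      interpret PI: prob_space "\<Pi>\<^sub>M i\<in>I. R J i" by (rule prob_space_PiM) (rule R_prob)
      interpret PI': prob_space "\<Pi>\<^sub>M i\<in>I'. R J i" by (rule prob_space_PiM) (rule R_prob)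
      interpret Rk: prob_space "R J k" by (rule R_prob)
      have m: "f \<in> borel_measurable (\<Pi>\<^sub>M i\<in>I. R J i)"
        using f by (subst measurable_cong_sets[OF sets_PiM_cong[OF refl R_sets] refl])
      have "integrable (\<Pi>\<^sub>M i\<in>I. R J i) f"
        by (rule PI.integrable_const_bound[of _ K]) (use m fb in auto)
      then show "(\<integral>x. f x \<partial>(\<Pi>\<^sub>M i\<in>I. R J i)) = (\<integral>x. (\<integral>y. f (x(k := y)) \<partial>R J k) \<partial>(\<Pi>\<^sub>M i\<in>I'. R J i))"
        using product_integral_insert[OF II(3,2)] unfolding II(1) by blast
      have "(\<lambda>(x, y). f (x(k := y))) \<in> borel_measurable ((\<Pi>\<^sub>M i\<in>I'. R J i) \<Otimes>\<^sub>M R J k)"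
        using measurable_compose[OF measurable_add_dim[of k I' "R J"], of f borel] m
        unfolding II(1) by (simp add: case_prod_beta')
      then have "(\<lambda>x. \<integral>y. f (x(k := y)) \<partial>R J k) \<in> borel_measurable (\<Pi>\<^sub>M i\<in>I'. R J i)"
        by (rule sigma_finite_measure.borel_measurable_lebesgue_integral[OF prob_space_imp_sigma_finite[OF R_prob]])
      moreover have "\<bar>\<integral>y. f (x(k := y)) \<partial>R J k\<bar> \<le> K" for x
      proof -
        have K0: "K \<ge> 0" using fb[of undefined] by linarith
        have "\<bar>\<integral>y. f (x(k := y)) \<partial>R J k\<bar> \<le> (\<integral>y. \<bar>f (x(k := y))\<bar> \<partial>R J k)"
          by (rule integral_abs_bound)
        also have "\<dots> \<le> (\<integral>y. K \<partial>R J k)"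
          by (rule integral_mono') (use fb K0 in auto)
        also have "\<dots> = K" using Rk.prob_space by simp
        finally show ?thesis .
      qed
      ultimately show "integrable (\<Pi>\<^sub>M i\<in>I'. R J i) (\<lambda>x. \<integral>y. f (x(k := y)) \<partial>R J k)"
        by (intro PI'.integrable_const_bound[of _ K]) auto
    qed
    interpret PI': prob_space "\<Pi>\<^sub>M i\<in>I'. R J i" by (rule prob_space_PiM) (rule R_prob)
    have same: "(\<Pi>\<^sub>M i\<in>I'. R (insert k J) i) = (\<Pi>\<^sub>M i\<in>I'. R J i)"
      using II(2) by (intro PiM_cong) (auto simp: R_def)
    have Rk: "R J k = P k" "R (insert k J) k = Q k" using insert.hyps by (auto simp: R_def)
    have "\<bar>(\<integral>x. f x \<partial>(\<Pi>\<^sub>M i\<in>I. R J i)) - (\<integral>x. f x \<partial>(\<Pi>\<^sub>M i\<in>I. R (insert k J) i))\<bar>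
        = \<bar>\<integral>x. (\<integral>y. f (x(k := y)) \<partial>P k) - (\<integral>y. f (x(k := y)) \<partial>Q k) \<partial>(\<Pi>\<^sub>M i\<in>I'. R J i)\<bar>"
      using fub[of J] fub[of "insert k J"]
      by (simp add: slice[of J] slice[of "insert k J"] Rk same)
    also have "\<dots> \<le> (\<integral>x. e \<partial>(\<Pi>\<^sub>M i\<in>I'. R J i))"
      using fub[of J] fub[of "insert k J"] exch[of k] insert.prems
      by (intro order_trans[OF integral_abs_bound] integral_mono) (auto simp: Rk same)
    also have "\<dots> = e" using PI'.prob_space by simp
    finally show ?case
      using insert by (simp add: algebra_simps)
  qed
  from this[OF I order_refl]
  have "\<bar>(\<integral>x. f x \<partial>(\<Pi>\<^sub>M k\<in>I. P k)) - (\<integral>x. f x \<partial>(\<Pi>\<^sub>M i\<in>I. R I i))\<bar> \<le> real (card I) * e" .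
  moreover have "(\<Pi>\<^sub>M i\<in>I. R I i) = (\<Pi>\<^sub>M k\<in>I. Q k)"
    by (intro PiM_cong) (auto simp: R_def)
  ultimately show ?thesis by simp
qed

section \<open>Maxima over discrete chains and their partition function\<close>

definition grid_chains :: "nat \<Rightarrow> nat \<Rightarrow> (nat \<Rightarrow> nat) set" where
  "grid_chains m n =
     {c \<in> {0..m} \<rightarrow>\<^sub>E {0..n}. c 0 = 0 \<and> c m = n \<and> (\<forall>r\<in>{1..m}. c (r - 1) \<le> c r)}"

text \<open>A chain \<open>c\<close> cuts \<open>{1..n}\<close> into the blocks \<open>{c (r - 1)<..c r}\<close>, and position \<open>k\<close> contributes the
  coordinate of \<open>y k\<close> that belongs to its block. The indicator form keeps the dependence on each
  single \<open>y k\<close> visibly linear.\<close>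
definition chain_sum :: "nat \<Rightarrow> nat \<Rightarrow> (nat \<Rightarrow> nat) \<Rightarrow> (nat \<Rightarrow> nat \<Rightarrow> real) \<Rightarrow> real" where
  "chain_sum m n c y = (\<Sum>r=1..m. \<Sum>k=1..n. of_bool (c (r - 1) < k \<and> k \<le> c r) * y k r)"

definition passage_max :: "nat \<Rightarrow> nat \<Rightarrow> (nat \<Rightarrow> nat \<Rightarrow> real) \<Rightarrow> real" where
  "passage_max m n y = Max ((\<lambda>c. chain_sum m n c y) ` grid_chains m n)"

definition partition_fun :: "nat \<Rightarrow> nat \<Rightarrow> real \<Rightarrow> (nat \<Rightarrow> nat \<Rightarrow> real) \<Rightarrow> real" where
  "partition_fun m n \<beta> y = (\<Sum>c\<in>grid_chains m n. exp (\<beta> * chain_sum m n c y))"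

lemma finite_grid_chains [simp]: "finite (grid_chains m n)"
  unfolding grid_chains_def by (rule finite_subset[of _ "{0..m} \<rightarrow>\<^sub>E {0..n}"]) (auto intro: finite_PiE)

text \<open>A crude polynomial bound suffices: the number of chains only has to be negligible against
  \<open>exp (\<delta> * \<beta>)\<close> when \<open>\<beta>\<close> is a power of \<open>n\<close>.\<close>
lemma card_grid_chains: "card (grid_chains m n) \<le> (n + 1) ^ (m + 1)"
proof -
  have "card (grid_chains m n) \<le> card ({0..m} \<rightarrow>\<^sub>E {0..n})"
    unfolding grid_chains_def by (intro card_mono) (auto intro: finite_PiE)
  then show ?thesis by (simp add: card_PiE)
qed

lemma grid_chains_nonempty:
  assumes "m \<ge> 1" shows "grid_chains m n \<noteq> {}"
proof -
  have "(\<lambda>r\<in>{0..m}. if r = 0 then 0 else n) \<in> grid_chains m n"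
    using assms by (auto simp: grid_chains_def)
  then show ?thesis by blast
qed

lemma grid_chains_mono:
  assumes c: "c \<in> grid_chains m n" and "i \<le> j" "j \<le> m"
  shows "c i \<le> c j"
  using \<open>i \<le> j\<close> \<open>j \<le> m\<close>
proof (induction j rule: dec_induct)
  case (step k)
  then have "Suc k \<in> {1..m}" by simp
  with c have "c (Suc k - 1) \<le> c (Suc k)" unfolding grid_chains_def by blast
  then show ?case using step by simp
qed simp

lemma passage_max_ge: "c \<in> grid_chains m n \<Longrightarrow> chain_sum m n c y \<le> passage_max m n y"
  unfolding passage_max_def by (intro Max_ge) auto

lemma passage_max_attained:
  assumes "m \<ge> 1"
  obtains c where "c \<in> grid_chains m n" "passage_max m n y = chain_sum m n c y"
proof -
  have "passage_max m n y \<in> (\<lambda>c. chain_sum m n c y) ` grid_chains m n"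
    unfolding passage_max_def using grid_chains_nonempty[OF assms] by (intro Max_in) auto
  then show ?thesis using that by blast
qed

lemma partition_fun_bounds:
  assumes m: "m \<ge> 1" and \<beta>: "\<beta> \<ge> 0"
  shows "exp (\<beta> * passage_max m n y) \<le> partition_fun m n \<beta> y"
    and "partition_fun m n \<beta> y \<le> (real n + 1) ^ (m + 1) * exp (\<beta> * passage_max m n y)"
proof -
  obtain c where c: "c \<in> grid_chains m n" "passage_max m n y = chain_sum m n c y"
    by (rule passage_max_attained[OF m])
  show "exp (\<beta> * passage_max m n y) \<le> partition_fun m n \<beta> y"
    unfolding c(2) partition_fun_def by (rule member_le_sum[OF c(1)]) auto
  have "partition_fun m n \<beta> y \<le> real (card (grid_chains m n)) * exp (\<beta> * passage_max m n y)"
    unfolding partition_fun_def using \<beta>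
    by (intro sum_bounded_above) (auto intro!: mult_left_mono passage_max_ge)
  also have "\<dots> \<le> real ((n + 1) ^ (m + 1)) * exp (\<beta> * passage_max m n y)"
    by (intro mult_right_mono of_nat_mono card_grid_chains) auto
  finally show "partition_fun m n \<beta> y \<le> (real n + 1) ^ (m + 1) * exp (\<beta> * passage_max m n y)"
    by (simp only: of_nat_power of_nat_add of_nat_1)
qed

lemma chain_sum_cong:
  assumes "\<And>k r. k \<in> {1..n} \<Longrightarrow> r \<in> {1..m} \<Longrightarrow> y k r = z k r"
  shows "chain_sum m n c y = chain_sum m n c z"
  unfolding chain_sum_def using assms by (intro sum.cong refl) auto

lemma passage_max_cong:
  assumes "\<And>k r. k \<in> {1..n} \<Longrightarrow> r \<in> {1..m} \<Longrightarrow> y k r = z k r"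
  shows "passage_max m n y = passage_max m n z"
  unfolding passage_max_def using chain_sum_cong[of n m y z, OF assms] by simp

lemma partition_fun_cong:
  assumes "\<And>k r. k \<in> {1..n} \<Longrightarrow> r \<in> {1..m} \<Longrightarrow> y k r = z k r"
  shows "partition_fun m n \<beta> y = partition_fun m n \<beta> z"
  unfolding partition_fun_def using chain_sum_cong[of n m y z, OF assms] by simp

lemma chain_sum_update:
  assumes k: "k \<in> {1..n}"
  shows "chain_sum m n c (x(k := y)) =
    chain_sum m n c (x(k := (\<lambda>_. 0))) + (\<Sum>r=1..m. of_bool (c (r - 1) < k \<and> k \<le> c r) * y r)"
proof -
  have "(\<Sum>j=1..n. of_bool (c (r - 1) < j \<and> j \<le> c r) * (x(k := y)) j r) =
    (\<Sum>j=1..n. of_bool (c (r - 1) < j \<and> j \<le> c r) * (x(k := (\<lambda>_. 0))) j r)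
      + of_bool (c (r - 1) < k \<and> k \<le> c r) * y r" for r
    using k by (subst (1 2) sum.remove[of _ k]) (auto intro!: sum.cong)
  then show ?thesis by (simp add: chain_sum_def sum.distrib)
qed

lemma measurable_chain_sum [measurable]:
  "chain_sum m n c \<in> borel_measurable (\<Pi>\<^sub>M k\<in>{1..n}. \<Pi>\<^sub>M r\<in>{1..m}. borel)"
proof -
  have "(\<lambda>y. y k r) \<in> borel_measurable (\<Pi>\<^sub>M k\<in>{1..n}. \<Pi>\<^sub>M r\<in>{1..m}. (borel :: real measure))"
    if "k \<in> {1..n}" "r \<in> {1..m}" for k r
    using measurable_compose[OF measurable_component_singleton[OF that(1)]
        measurable_component_singleton[OF that(2)]] .
  then show ?thesis
    unfolding chain_sum_def by (intro borel_measurable_sum borel_measurable_times) auto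
qed

lemma measurable_partition_fun [measurable]:
  "partition_fun m n \<beta> \<in> borel_measurable (\<Pi>\<^sub>M k\<in>{1..n}. \<Pi>\<^sub>M r\<in>{1..m}. borel)"
  unfolding partition_fun_def by measurable

lemma measurable_passage_max [measurable]:
  "passage_max m n \<in> borel_measurable (\<Pi>\<^sub>M k\<in>{1..n}. \<Pi>\<^sub>M r\<in>{1..m}. borel)"
  unfolding passage_max_def by measurable

text \<open>As a function of the single vector \<open>y k\<close>, the partition function is a positive combination of
  exponentials of linear forms, so the exchange estimate for one vector applies with \<open>\<theta>\<close> and the
  contribution of the other vectors absorbed into the weights.\<close>
lemma partition_fun_universality_product:
  assumes P: "\<And>k. centered_vector_law m C \<tau> (P k)" and Q: "\<And>k. centered_vector_law m C \<tau> (Q k)"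
    and \<beta>: "\<beta> \<ge> 0" and \<theta>: "\<theta> \<ge> 0"
  shows "\<bar>(\<integral>y. exp (- (\<theta> * partition_fun m n \<beta> y)) \<partial>(\<Pi>\<^sub>M k\<in>{1..n}. P k))
      - (\<integral>y. exp (- (\<theta> * partition_fun m n \<beta> y)) \<partial>(\<Pi>\<^sub>M k\<in>{1..n}. Q k))\<bar>
    \<le> real n * (9 * real m ^ 4 * \<beta> ^ 3 * \<tau>)"
proof -
  have pos: "\<theta> * partition_fun m n \<beta> x \<ge> 0" for x
    using \<theta> by (auto simp: partition_fun_def intro!: mult_nonneg_nonneg sum_nonneg)
  have meas: "(\<lambda>y. exp (- (\<theta> * partition_fun m n \<beta> y)))
      \<in> borel_measurable (\<Pi>\<^sub>M k\<in>{1..n}. \<Pi>\<^sub>M r\<in>{1..m}. borel)"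
    by measurable
  have exch: "\<bar>(\<integral>y. exp (- (\<theta> * partition_fun m n \<beta> (x(k := y)))) \<partial>P k)
      - (\<integral>y. exp (- (\<theta> * partition_fun m n \<beta> (x(k := y)))) \<partial>Q k)\<bar> \<le> 9 * real m ^ 4 * \<beta> ^ 3 * \<tau>"
    if k: "k \<in> {1..n}" for k x
  proof -
    define w where "w c = \<theta> * exp (\<beta> * chain_sum m n c (x(k := (\<lambda>_. 0))))" for c
    define b where "b c r = \<beta> * of_bool (c (r - 1) < k \<and> k \<le> c r)" for c and r :: nat
    have "\<theta> * partition_fun m n \<beta> (x(k := y))
        = (\<Sum>c\<in>grid_chains m n. w c * exp (\<Sum>r=1..m. b c r * y r))" for y
      unfolding partition_fun_def chain_sum_update[OF k, of m _ x y]
      by (simp add: w_def b_def sum_distrib_left distrib_left exp_add mult.assoc del: sum_mult_of_bool_eq sum_of_bool_mult_eq)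
    then show ?thesis
      using centered_vector_law_exchange[OF P[of k] Q[of k] finite_grid_chains, where w = w and b = b and \<beta> = \<beta>] \<beta> \<theta>
      by (simp add: w_def b_def)
  qed
  have "\<bar>(\<integral>y. exp (- (\<theta> * partition_fun m n \<beta> y)) \<partial>(\<Pi>\<^sub>M k\<in>{1..n}. P k))
      - (\<integral>y. exp (- (\<theta> * partition_fun m n \<beta> y)) \<partial>(\<Pi>\<^sub>M k\<in>{1..n}. Q k))\<bar>
    \<le> real (card {1..n}) * (9 * real m ^ 4 * \<beta> ^ 3 * \<tau>)"
    by (rule product_measure_exchange[where S = "\<Pi>\<^sub>M r\<in>{1..m}. borel" and K = 1])
      (use P Q meas exch pos in \<open>simp_all add: centered_vector_law_def\<close>)
  then show ?thesis by simp
qed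

text \<open>Independence identifies the joint law with a product measure, on which single factors can be
  exchanged.\<close>
lemma expectation_partition_fun_indep:
  fixes U :: "nat \<Rightarrow> 'a \<Rightarrow> nat \<Rightarrow> real"
  assumes M: "prob_space M" and n: "n \<ge> 1"
    and ind: "prob_space.indep_vars M (\<lambda>_. \<Pi>\<^sub>M r\<in>{1..m}. borel) U {1..n}"
    and law: "\<And>k. k \<in> {1..n} \<Longrightarrow> distr M (\<Pi>\<^sub>M r\<in>{1..m}. borel) (U k) = P"
  shows "(\<integral>\<omega>. exp (- (\<theta> * partition_fun m n \<beta> (\<lambda>k. U k \<omega>))) \<partial>M)
    = (\<integral>y. exp (- (\<theta> * partition_fun m n \<beta> y)) \<partial>(\<Pi>\<^sub>M k\<in>{1..n}. P))"
proof -
  interpret prob_space M by fact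
  let ?B = "\<Pi>\<^sub>M r\<in>{1..m}. (borel :: real measure)"
  have rv: "U k \<in> measurable M ?B" if "k \<in> {1..n}" for k
    using ind that by (auto simp: indep_vars_def)
  have "distr M (\<Pi>\<^sub>M k\<in>{1..n}. ?B) (\<lambda>\<omega>. \<lambda>k\<in>{1..n}. U k \<omega>) = (\<Pi>\<^sub>M k\<in>{1..n}. distr M ?B (U k))"
    using indep_vars_iff_distr_eq_PiM'[of "{1..n}" U "\<lambda>_. ?B"] ind rv n by auto
  also have "\<dots> = (\<Pi>\<^sub>M k\<in>{1..n}. P)"
    using law by (intro PiM_cong) auto
  finally have "(\<integral>y. exp (- (\<theta> * partition_fun m n \<beta> y)) \<partial>(\<Pi>\<^sub>M k\<in>{1..n}. P))
     = (\<integral>y. exp (- (\<theta> * partition_fun m n \<beta> y)) \<partial>distr M (\<Pi>\<^sub>M k\<in>{1..n}. ?B) (\<lambda>\<omega>. \<lambda>k\<in>{1..n}. U k \<omega>))"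
    by simp
  also have "\<dots> = (\<integral>\<omega>. exp (- (\<theta> * partition_fun m n \<beta> (\<lambda>k\<in>{1..n}. U k \<omega>))) \<partial>M)"
  proof (rule integral_distr)
    show "(\<lambda>\<omega>. \<lambda>k\<in>{1..n}. U k \<omega>) \<in> measurable M (\<Pi>\<^sub>M k\<in>{1..n}. ?B)"
      by (rule measurable_restrict) (rule rv)
  qed measurable
  also have "(\<lambda>\<omega>. partition_fun m n \<beta> (\<lambda>k\<in>{1..n}. U k \<omega>)) = (\<lambda>\<omega>. partition_fun m n \<beta> (\<lambda>k. U k \<omega>))"
    by (intro ext partition_fun_cong) simp
  finally show ?thesis by simp
qed

lemma partition_fun_universality:
  fixes U :: "nat \<Rightarrow> 'a \<Rightarrow> nat \<Rightarrow> real" and V :: "nat \<Rightarrow> 'b \<Rightarrow> nat \<Rightarrow> real"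
  assumes M: "prob_space M" and N: "prob_space N" and n: "n \<ge> 1"
    and indU: "prob_space.indep_vars M (\<lambda>_. \<Pi>\<^sub>M r\<in>{1..m}. borel) U {1..n}"
    and indV: "prob_space.indep_vars N (\<lambda>_. \<Pi>\<^sub>M r\<in>{1..m}. borel) V {1..n}"
    and lawU: "\<And>k. k \<in> {1..n} \<Longrightarrow> distr M (\<Pi>\<^sub>M r\<in>{1..m}. borel) (U k) = P"
    and lawV: "\<And>k. k \<in> {1..n} \<Longrightarrow> distr N (\<Pi>\<^sub>M r\<in>{1..m}. borel) (V k) = Q"
    and P: "centered_vector_law m C \<tau> P" and Q: "centered_vector_law m C \<tau> Q"
    and \<beta>: "\<beta> \<ge> 0" and \<theta>: "\<theta> \<ge> 0"
  shows "\<bar>(\<integral>\<omega>. exp (- (\<theta> * partition_fun m n \<beta> (\<lambda>k. U k \<omega>))) \<partial>M)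
      - (\<integral>\<omega>. exp (- (\<theta> * partition_fun m n \<beta> (\<lambda>k. V k \<omega>))) \<partial>N)\<bar>
    \<le> real n * (9 * real m ^ 4 * \<beta> ^ 3 * \<tau>)"
  using partition_fun_universality_product[of m C \<tau> "\<lambda>_. P" "\<lambda>_. Q" \<beta> \<theta> n] P Q \<beta> \<theta>
    expectation_partition_fun_indep[OF M n indU, of P \<theta> \<beta>] lawU
    expectation_partition_fun_indep[OF N n indV, of Q \<theta> \<beta>] lawV
  by simp

lemma chain_sum_intervals:
  assumes c: "c \<in> grid_chains m n"
  shows "chain_sum m n c y = (\<Sum>r=1..m. \<Sum>k\<in>{c (r - 1)<..c r}. y k r)"
  unfolding chain_sum_def
proof (rule sum.cong[OF refl])
  fix r assume r: "r \<in> {1..m}"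
  then have "c r \<le> n" using c by (auto simp: grid_chains_def PiE_iff)
  have "(\<Sum>k=1..n. of_bool (c (r - 1) < k \<and> k \<le> c r) * y k r)
     = (\<Sum>k\<in>{1..n}. if k \<in> {c (r - 1)<..c r} then y k r else 0)"
    by (intro sum.cong) auto
  also have "\<dots> = (\<Sum>k\<in>{1..n} \<inter> {c (r - 1)<..c r}. y k r)"
    by (simp add: sum.inter_restrict)
  also have "{1..n} \<inter> {c (r - 1)<..c r} = {c (r - 1)<..c r}" using \<open>c r \<le> n\<close> by auto
  finally show "(\<Sum>k=1..n. of_bool (c (r - 1) < k \<and> k \<le> c r) * y k r) = (\<Sum>k\<in>{c (r - 1)<..c r}. y k r)" .
qed

lemma sum_telescope_pred:
  fixes f :: "nat \<Rightarrow> 'a::ab_group_add"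
  assumes "a \<le> b"
  shows "(\<Sum>k\<in>{a<..b}. f k - f (k - 1)) = f b - f a"
  using assms
proof (induction b rule: dec_induct)
  case (step b)
  then have "{a<..Suc b} = insert (Suc b) {a<..b}" by auto
  then show ?case using step by simp
qed simp

lemma chain_sum_telescope:
  assumes c: "c \<in> grid_chains m n"
  shows "chain_sum m n c (\<lambda>k r. f r k - f r (k - 1)) = (\<Sum>r=1..m. f r (c r) - f r (c (r - 1)))"
  unfolding chain_sum_intervals[OF c]
  using grid_chains_mono[OF c] by (intro sum.cong sum_telescope_pred) auto

lemma chain_sum_const:
  assumes c: "c \<in> grid_chains m n"
  shows "chain_sum m n c (\<lambda>_ _. 1) = real n"
proof -
  have "chain_sum m n c (\<lambda>_ _. 1) = (\<Sum>r=1..m. \<Sum>k\<in>{c (r - 1)<..c r}. 1)"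
    by (rule chain_sum_intervals[OF c])
  also have "\<dots> = (\<Sum>r\<in>{0<..m}. real (c r) - real (c (r - 1)))"
    using grid_chains_mono[OF c] by (intro sum.cong) (auto simp: of_nat_diff)
  also have "\<dots> = real n"
    using c by (subst sum_telescope_pred[of 0 m "\<lambda>r. real (c r)"]) (auto simp: grid_chains_def)
  finally show ?thesis .
qed

text \<open>Every chain collects exactly one entry from each of the \<open>n\<close> positions, so centring the entries
  shifts all chain sums by the same amount. For \<open>n = 0\<close> the scaling \<open>1 / sqrt n\<close> is \<open>0\<close>, which is why
  \<open>s = 0\<close> is included.\<close>
lemma passage_max_center:
  assumes m: "m \<ge> 1" and s: "s \<ge> 0"
  shows "passage_max m n (\<lambda>k r. (y k r - a) * s) = (passage_max m n y - real n * a) * s"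
proof -
  have lin: "chain_sum m n c (\<lambda>k r. (y k r - a) * s) = (chain_sum m n c y - real n * a) * s"
    if c: "c \<in> grid_chains m n" for c
  proof -
    have "chain_sum m n c (\<lambda>k r. (y k r - a) * s) = (chain_sum m n c y - chain_sum m n c (\<lambda>_ _. 1) * a) * s"
      unfolding chain_sum_def sum_distrib_right sum_subtractf[symmetric]
      by (intro sum.cong refl) (simp add: algebra_simps)
    then show ?thesis by (simp add: chain_sum_const[OF c])
  qed
  obtain c where c: "c \<in> grid_chains m n" "passage_max m n y = chain_sum m n c y"
    by (rule passage_max_attained[OF m])
  show ?thesis
    unfolding passage_max_def[of m n "\<lambda>k r. (y k r - a) * s"]
  proof (rule Max_eqI)
    show "(passage_max m n y - real n * a) * s \<in> (\<lambda>c. chain_sum m n c (\<lambda>k r. (y k r - a) * s)) ` grid_chains m n"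
      using c lin[OF c(1)] by (intro image_eqI[of _ _ c]) auto
  qed (use passage_max_ge s in \<open>auto simp: lin intro!: mult_right_mono\<close>)
qed

section \<open>Increasing subsequences as maxima over chains\<close>

lemma increasing_subsequence_iff_subset:
  fixes x :: "nat \<Rightarrow> 'c::linorder"
  shows "(\<exists>i. i ` {1..l} \<subseteq> {1..n} \<and> strict_mono_on {1..l} i \<and> mono_on {1..l} (\<lambda>k. x (i k)))
    \<longleftrightarrow> (\<exists>S. S \<subseteq> {1..n} \<and> mono_on S x \<and> card S = l)"
proof
  assume "\<exists>i. i ` {1..l} \<subseteq> {1..n} \<and> strict_mono_on {1..l} i \<and> mono_on {1..l} (\<lambda>k. x (i k))"
  then obtain i where i: "i ` {1..l} \<subseteq> {1..n}" "strict_mono_on {1..l} i" "mono_on {1..l} (\<lambda>k. x (i k))"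
    by blast
  have "mono_on (i ` {1..l}) x"
  proof (rule mono_onI)
    fix u v assume "u \<in> i ` {1..l}" "v \<in> i ` {1..l}" "u \<le> v"
    then obtain j k where jk: "j \<in> {1..l}" "k \<in> {1..l}" "u = i j" "v = i k" by blast
    have "j \<le> k"
      using strict_mono_onD[OF i(2), of k j] jk \<open>u \<le> v\<close> by (meson leD linorder_le_less_linear)
    then show "x u \<le> x v" using mono_onD[OF i(3)] jk by blast
  qed
  moreover have "card (i ` {1..l}) = l"
    using strict_mono_on_imp_inj_on[OF i(2)] by (simp add: card_image)
  ultimately show "\<exists>S. S \<subseteq> {1..n} \<and> mono_on S x \<and> card S = l" using i(1) by blast
next
  assume "\<exists>S. S \<subseteq> {1..n} \<and> mono_on S x \<and> card S = l"
  then obtain S where S: "S \<subseteq> {1..n}" "mono_on S x" "card S = l" by blast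
  then have "finite S" using finite_subset by blast
  define i where "i k = sorted_list_of_set S ! (k - 1)" for k
  have len: "length (sorted_list_of_set S) = l" using S(3) by simp
  have strict: "sorted_wrt (<) (sorted_list_of_set S)" by simp
  have i_in: "i k \<in> S" if "k \<in> {1..l}" for k
    using nth_mem[of "k - 1" "sorted_list_of_set S"] that len \<open>finite S\<close> by (auto simp: i_def)
  have mono: "strict_mono_on {1..l} i"
  proof (rule strict_mono_onI)
    fix r s assume "r \<in> {1..l}" "s \<in> {1..l}" "r < s"
    then show "i r < i s"
      unfolding i_def using len by (intro sorted_wrt_nth_less[OF strict]) auto
  qed
  have "mono_on {1..l} (\<lambda>k. x (i k))"
  proof (rule mono_onI)
    fix j k assume "j \<in> {1..l}" "k \<in> {1..l}" "j \<le> k"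
    then show "x (i j) \<le> x (i k)"
      using mono_onD[OF S(2) i_in i_in] strict_mono_onD[OF mono, of j k] by (cases "j = k") auto
  qed
  then show "\<exists>i. i ` {1..l} \<subseteq> {1..n} \<and> strict_mono_on {1..l} i \<and> mono_on {1..l} (\<lambda>k. x (i k))"
    using i_in S(1) mono by blast
qed

lemma longest_increasing_subsets:
  "longest_increasing x n = Max {card S | S. S \<subseteq> {1..n} \<and> mono_on S x}"
proof -
  have "{l. \<exists>S. S \<subseteq> {1..n} \<and> mono_on S x \<and> card S = l} = {card S | S. S \<subseteq> {1..n} \<and> mono_on S x}"
   by blast
  then show ?thesis
  unfolding longest_increasing_def increasing_subsequence_iff_subset by simp
qed
lemma chain_sum_matches:
  assumes c: "c \<in> grid_chains m n"
  shows "chain_sum m n c (\<lambda>k r. of_bool (x k = \<alpha> r))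
    = real (\<Sum>r=1..m. card {k \<in> {c (r - 1)<..c r}. x k = \<alpha> r})"
proof -
  have "(\<Sum>k\<in>A. of_bool (x k = \<alpha> r)) = real (card {k\<in>A. x k = \<alpha> r})" if "finite A" for A r
   using that by (simp add: Int_def)
  then show ?thesis
  unfolding chain_sum_intervals[OF c] of_nat_sum
  by simp
qed

text \<open>The positions that carry the letter of their block form an increasing subsequence, because the
  block index does not decrease along the word.\<close>
lemma increasing_set_of_chain:
  fixes x :: "nat \<Rightarrow> 'c::linorder"
  assumes c: "c \<in> grid_chains m n" and \<alpha>: "strict_mono_on {1..m} \<alpha>"
  shows "\<exists>S. S \<subseteq> {1..n} \<and> mono_on S x \<and>
    card S = (\<Sum>r=1..m. card {k \<in> {c (r - 1)<..c r}. x k = \<alpha> r})"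
proof -
  define T where "T r = {k \<in> {c (r - 1)<..c r}. x k = \<alpha> r}" for r
  have T_sub: "T r \<subseteq> {1..n}" if "r \<in> {1..m}" for r
    using c that by (auto simp: grid_chains_def PiE_iff T_def dest!: bspec[of _ _ r])
  have T_mono: "r \<le> s" if "r \<in> {1..m}" "s \<in> {1..m}" "k \<in> T r" "l \<in> T s" "k \<le> l" for r s k l
  proof (rule ccontr)
    assume "\<not> r \<le> s"
    then have "c s \<le> c (r - 1)" using that by (intro grid_chains_mono[OF c]) auto
    then show False using that by (auto simp: T_def)
  qed
  have "mono_on (\<Union>r\<in>{1..m}. T r) x"
  proof (rule mono_onI)
    fix k l assume "k \<in> (\<Union>r\<in>{1..m}. T r)" "l \<in> (\<Union>r\<in>{1..m}. T r)" "k \<le> l"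
    then obtain r s where rs: "r \<in> {1..m}" "s \<in> {1..m}" "k \<in> T r" "l \<in> T s" by blast
    then have "\<alpha> r \<le> \<alpha> s"
      using T_mono[OF rs \<open>k \<le> l\<close>] strict_mono_onD[OF \<alpha>, of r s] by (cases "r = s") auto
    then show "x k \<le> x l" using rs by (auto simp: T_def)
  qed
  moreover have "card (\<Union>r\<in>{1..m}. T r) = (\<Sum>r=1..m. card (T r))"
  proof (rule card_UN_disjoint)
    show "\<forall>r\<in>{1..m}. \<forall>s\<in>{1..m}. r \<noteq> s \<longrightarrow> T r \<inter> T s = {}"
      using T_mono by (meson disjoint_iff order_antisym order_refl)
  qed (auto simp: T_def)
  moreover have "(\<Union>r\<in>{1..m}. T r) \<subseteq> {1..n}" using T_sub by blast
  ultimately show ?thesis unfolding T_def by blast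
qed

text \<open>Conversely, an increasing subsequence \<open>S\<close> is cut at the last position at which it shows one of the
  first \<open>r\<close> letters. The extra element \<open>0\<close> covers the case that it shows none of them, and the last cut is
  moved to \<open>n\<close>, as a chain has to end there.\<close>
lemma chain_of_increasing_set:
  fixes x :: "nat \<Rightarrow> 'c::linorder"
  assumes m: "m \<ge> 1" and \<alpha>: "strict_mono_on {1..m} \<alpha>"
    and x: "\<And>k. k \<in> {1..n} \<Longrightarrow> x k \<in> \<alpha> ` {1..m}"
    and S: "S \<subseteq> {1..n}" "mono_on S x"
  shows "\<exists>c\<in>grid_chains m n. card S \<le> (\<Sum>r=1..m. card {k \<in> {c (r - 1)<..c r}. x k = \<alpha> r})"
proof -
  have fin: "finite S" using S(1) finite_subset by blast
  define W where "W r = insert 0 {k \<in> S. \<exists>s\<in>{1..r}. x k = \<alpha> s}" for r :: nat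
  have W: "finite (W r)" "W r \<noteq> {}" "W r \<subseteq> {0..n}" for r
    using fin S(1) by (auto simp: W_def)
  define c where "c = (\<lambda>r\<in>{0..m}. if r = m then n else Max (W r))"
  have cW: "Max (W r) \<le> n" for r
    using W[of r] by (subst Max_le_iff) auto
  have c: "c \<in> grid_chains m n"
    unfolding grid_chains_def
  proof (intro CollectI conjI ballI)
    show "c \<in> {0..m} \<rightarrow>\<^sub>E {0..n}" using cW by (auto simp: c_def)
    show "c 0 = 0" "c m = n" using m by (auto simp: c_def W_def)
    fix r assume r: "r \<in> {1..m}"
    have "Max (W (r - 1)) \<le> Max (W r)"
      using W(1,2) by (intro Max_mono) (fastforce simp: W_def)+
    then show "c (r - 1) \<le> c r" using r cW by (auto simp: c_def)
  qed
  have "S \<subseteq> (\<Union>r\<in>{1..m}. {k \<in> {c (r - 1)<..c r}. x k = \<alpha> r})"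
  proof
    fix k assume k: "k \<in> S"
    then obtain r where r: "r \<in> {1..m}" "x k = \<alpha> r" using x S(1) by blast
    have "k \<le> c r"
      using k r S(1) W by (auto simp: c_def W_def intro!: Max_ge)
    moreover have "c (r - 1) < k"
    proof -
      have "j < k" if j: "j \<in> W (r - 1)" for j
      proof (cases "j = 0")
        case True
        then show ?thesis using k S(1) by auto
      next
        case False
        then obtain s where s: "j \<in> S" "s \<in> {1..r - 1}" "x j = \<alpha> s" using j by (auto simp: W_def)
        then have "\<alpha> s < \<alpha> r" using r by (intro strict_mono_onD[OF \<alpha>]) auto
        then show ?thesis using mono_onD[OF S(2) k s(1)] s r by (cases "k \<le> j") auto
      qed
      then show ?thesis using r W by (auto simp: c_def)
    qed
    ultimately show "k \<in> (\<Union>r\<in>{1..m}. {k \<in> {c (r - 1)<..c r}. x k = \<alpha> r})"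
      using r by (intro UN_I[of r]) auto
  qed
  then have "card S \<le> card (\<Union>r\<in>{1..m}. {k \<in> {c (r - 1)<..c r}. x k = \<alpha> r})"
    by (intro card_mono) auto
  also have "\<dots> \<le> (\<Sum>r=1..m. card {k \<in> {c (r - 1)<..c r}. x k = \<alpha> r})"
    by (rule card_UN_le) simp
  finally show ?thesis using c by blast
qed

lemma longest_increasing_eq_passage_max:
  fixes x :: "nat \<Rightarrow> 'c::linorder"
  assumes m: "m \<ge> 1" and \<alpha>: "strict_mono_on {1..m} \<alpha>"
    and x: "\<And>k. k \<in> {1..n} \<Longrightarrow> x k \<in> \<alpha> ` {1..m}"
  shows "real (longest_increasing x n) = passage_max m n (\<lambda>k r. of_bool (x k = \<alpha> r))"
proof (rule antisym)
  let ?L = "{card S | S. S \<subseteq> {1..n} \<and> mono_on S x}"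
  have fin: "finite ?L"
    by (rule finite_subset[of _ "{0..n}"]) (auto dest: card_mono[rotated])
  have "longest_increasing x n \<in> ?L"
    unfolding longest_increasing_subsets
  proof (rule Max_in[OF fin])
    have "card {} \<in> ?L" by (rule CollectI, rule exI[of _ "{}"]) (simp add: mono_on_def)
    then show "?L \<noteq> {}" by blast
  qed
  then obtain S where S: "S \<subseteq> {1..n}" "mono_on S x" "longest_increasing x n = card S" by blast
  obtain c where c: "c \<in> grid_chains m n"
    "card S \<le> (\<Sum>r=1..m. card {k \<in> {c (r - 1)<..c r}. x k = \<alpha> r})"
    using chain_of_increasing_set[OF m \<alpha> x S(1,2)] by blast
  then have "real (longest_increasing x n) \<le> chain_sum m n c (\<lambda>k r. of_bool (x k = \<alpha> r))"
    unfolding chain_sum_matches[OF c(1)] S(3) by (intro of_nat_mono)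
  also have "\<dots> \<le> passage_max m n (\<lambda>k r. of_bool (x k = \<alpha> r))"
    by (rule passage_max_ge[OF c(1)])
  finally show "real (longest_increasing x n) \<le> passage_max m n (\<lambda>k r. of_bool (x k = \<alpha> r))" .
  obtain c where c: "c \<in> grid_chains m n"
    "passage_max m n (\<lambda>k r. of_bool (x k = \<alpha> r)) = chain_sum m n c (\<lambda>k r. of_bool (x k = \<alpha> r))"
    by (rule passage_max_attained[OF m])
  obtain S where S: "S \<subseteq> {1..n}" "mono_on S x"
    "card S = (\<Sum>r=1..m. card {k \<in> {c (r - 1)<..c r}. x k = \<alpha> r})"
    using increasing_set_of_chain[OF c(1) \<alpha>, of x] by blast
  have "(\<Sum>r=1..m. card {k \<in> {c (r - 1)<..c r}. x k = \<alpha> r}) \<le> longest_increasing x n"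
    unfolding longest_increasing_subsets S(3)[symmetric] using S(1,2) by (intro Max_ge[OF fin]) blast
  then show "passage_max m n (\<lambda>k r. of_bool (x k = \<alpha> r)) \<le> real (longest_increasing x n)"
    unfolding c(2) chain_sum_matches[OF c(1)] by (intro of_nat_mono)
qed

section \<open>Discretised paths\<close>
lemma nat_floor_ratio_tendsto:
  fixes t :: real assumes "t \<ge> 0"
  shows "(\<lambda>n. real (nat \<lfloor>real n * t\<rfloor>) / real n) \<longlonglongrightarrow> t"
proof (rule tendsto_sandwich[of "\<lambda>n. t - 1 / real n" _ _ "\<lambda>_. t"])
  show "eventually (\<lambda>n. t - 1 / real n \<le> real (nat \<lfloor>real n * t\<rfloor>) / real n) sequentially"
    using eventually_gt_at_top[of 0]
  proof eventually_elim
    case (elim n)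
    have "real n * t - 1 \<le> real (nat \<lfloor>real n * t\<rfloor>)" using assms by linarith
    then have "(real n * t - 1) / real n \<le> real (nat \<lfloor>real n * t\<rfloor>) / real n"
      by (intro divide_right_mono) auto
    then show ?case using elim by (simp add: diff_divide_distrib)
  qed
  show "eventually (\<lambda>n. real (nat \<lfloor>real n * t\<rfloor>) / real n \<le> t) sequentially"
    using eventually_gt_at_top[of 0]
  proof eventually_elim
    case (elim n)
    have "real (nat \<lfloor>real n * t\<rfloor>) \<le> real n * t" using assms by simp
    then show ?case using elim by (simp add: field_simps)
  qed
  show "(\<lambda>n. t - 1 / real n) \<longlonglongrightarrow> t" by real_asymp
qed simp

text \<open>A discrete chain is a chain of times in disguise, so the discrete maximum never exceeds the
  continuous one. Rounding a maximising chain of times down to the grid gives a matching lower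
  bound, by continuity of the paths.\<close>
lemma passage_max_path_tendsto:
  assumes m: "m \<ge> 1" and cont: "\<And>i. i \<in> {1..m} \<Longrightarrow> continuous_on {0..1} (b i)" and s: "s \<ge> 0"
  shows "(\<lambda>n. passage_max m n (\<lambda>k r. s * b r (real k / real n) - s * b r (real (k - 1) / real n)))
     \<longlonglongrightarrow> s * chain_max m b"
proof -
  let ?v = "\<lambda>t. \<Sum>i=1..m. b i (t i) - b i (t (i - 1))"
  define Y where "Y n = passage_max m n (\<lambda>k r. s * b r (real k / real n) - s * b r (real (k - 1) / real n))" for n
  obtain t where t: "t \<in> chains m" "chain_max m b = ?v t"
    and max: "\<And>u. u \<in> chains m \<Longrightarrow> ?v u \<le> chain_max m b"
    using chain_max_attained[of m b, OF m cont] by blast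
  have val: "chain_sum m n c (\<lambda>k r. s * b r (real k / real n) - s * b r (real (k - 1) / real n))
     = s * ?v (\<lambda>r. real (c r) / real n)" if "c \<in> grid_chains m n" for c n
    unfolding chain_sum_telescope[OF that, of "\<lambda>r k. s * b r (real k / real n)"]
    by (simp add: sum_distrib_left right_diff_distrib)
  define c where "c n = (\<lambda>r\<in>{0..m}. nat \<lfloor>real n * t r\<rfloor>)" for n
  have t01: "t r \<in> {0..1}" if "r \<le> m" for r using chains_bounds[OF t(1) that] .
  have c: "c n \<in> grid_chains m n" for n
    unfolding grid_chains_def
  proof (intro CollectI conjI ballI)
    have "nat \<lfloor>real n * t r\<rfloor> \<le> n" if "r \<le> m" for r
    proof -
      have "real n * t r \<le> real n" using t01[OF that] by (simp add: mult_left_le)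
      then show ?thesis by linarith
    qed
    then show "c n \<in> {0..m} \<rightarrow>\<^sub>E {0..n}" by (auto simp: c_def)
    show "c n 0 = 0" "c n m = n" using t(1) by (auto simp: c_def chains_def)
    fix r assume r: "r \<in> {1..m}"
    then have "t (r - 1) \<le> t r" using t(1) by (auto simp: chains_def)
    then have "real n * t (r - 1) \<le> real n * t r" by (intro mult_left_mono) auto
    then show "c n (r - 1) \<le> c n r" using r by (auto simp: c_def intro!: nat_mono floor_mono)
  qed
  have c_lim: "(\<lambda>n. real (c n r) / real n) \<longlonglongrightarrow> t r" if "r \<le> m" for r
    using nat_floor_ratio_tendsto[of "t r"] t01[OF that] that by (simp add: c_def)
  have c01: "eventually (\<lambda>n. real (c n r) / real n \<in> {0..1}) sequentially" if "r \<le> m" for r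
  proof (rule always_eventually, rule allI)
    fix n have "c n r \<le> n" using c[of n] that by (auto simp: grid_chains_def PiE_iff)
    then show "real (c n r) / real n \<in> {0..1}" by (auto simp: divide_le_eq_1)
  qed
  have b_lim: "(\<lambda>n. b i (real (c n r) / real n)) \<longlonglongrightarrow> b i (t r)" if "i \<in> {1..m}" "r \<le> m" for i r
    using that by (intro continuous_on_tendsto_compose[OF cont c_lim] t01 c01)
  have "(\<lambda>n. s * ?v (\<lambda>r. real (c n r) / real n)) \<longlonglongrightarrow> s * ?v t"
    by (intro tendsto_intros b_lim) auto
  then have low: "(\<lambda>n. s * ?v (\<lambda>r. real (c n r) / real n)) \<longlonglongrightarrow> s * chain_max m b"
    by (simp add: t(2))
  show ?thesis
    unfolding Y_def[symmetric]
  proof (rule tendsto_sandwich[OF _ _ low tendsto_const])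
    show "eventually (\<lambda>n. s * ?v (\<lambda>r. real (c n r) / real n) \<le> Y n) sequentially"
    proof (intro always_eventually allI)
      fix n
      have "chain_sum m n (c n) (\<lambda>k r. s * b r (real k / real n) - s * b r (real (k - 1) / real n)) \<le> Y n"
        unfolding Y_def by (rule passage_max_ge[OF c])
      then show "s * ?v (\<lambda>r. real (c n r) / real n) \<le> Y n"
        unfolding val[OF c[of n]] .
    qed
    show "eventually (\<lambda>n. Y n \<le> s * chain_max m b) sequentially"
      using eventually_gt_at_top[of 0]
    proof eventually_elim
      case (elim n)
      obtain d where d: "d \<in> grid_chains m n" "Y n = s * ?v (\<lambda>r. real (d r) / real n)"
      proof (rule passage_max_attained[OF m])
        fix d assume d: "d \<in> grid_chains m n" "passage_max m n (\<lambda>k r. s * b r (real k / real n) - s * b r (real (k - 1) / real n))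
          = chain_sum m n d (\<lambda>k r. s * b r (real k / real n) - s * b r (real (k - 1) / real n))"
        show thesis using that[OF d(1)] d(2) unfolding val[OF d(1)] Y_def by blast
      qed
      have "(\<lambda>r. real (d r) / real n) \<in> chains m"
        using d(1) elim by (auto simp: chains_def grid_chains_def divide_right_mono)
      then show ?case unfolding d(2) using s max by (intro mult_left_mono) auto
    qed
  qed
qed

section \<open>Convergence in distribution from soft indicators\<close>

text \<open>
  The functions \<open>hM\<close> and \<open>hN\<close> below are soft indicators of \<open>A n \<le> x\<close> and \<open>Yn n \<le> x\<close>; the sandwich
  of the partition functions \<open>Z\<close> and \<open>W\<close> makes them sharp up to a shift of \<open>x\<close> by \<open>\<delta>\<close>. On \<open>N\<close>,
  where the \<open>Yn n\<close> converge pointwise, they tend to the true indicator wherever \<open>Y \<noteq> x\<close>, and dominated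
  convergence applies; the bounds are then transported to \<open>M\<close>. Shifting \<open>x\<close> by
  \<open>\<delta>\<close> in both directions is harmless at a continuity point of the limiting distribution function.
\<close>
lemma weak_conv_m_by_soft_indicators:
  fixes A :: "nat \<Rightarrow> 'a \<Rightarrow> real" and Yn :: "nat \<Rightarrow> 'b \<Rightarrow> real"
  assumes M: "prob_space M" and N: "prob_space N"
    and A [measurable]: "\<And>n. A n \<in> borel_measurable M" and Z [measurable]: "\<And>n. Z n \<in> borel_measurable M"
    and Y [measurable]: "Y \<in> borel_measurable N" and W [measurable]: "\<And>n. W n \<in> borel_measurable N"
    and \<beta>: "filterlim \<beta> at_top sequentially" and \<beta>0: "\<And>n. \<beta> n \<ge> 0"
    and \<kappa>: "\<And>\<delta>. \<delta> > 0 \<Longrightarrow> (\<lambda>n. \<kappa> n * exp (- (\<beta> n * \<delta>))) \<longlonglongrightarrow> 0"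
    and ZA: "\<And>n \<omega>. \<omega> \<in> space M \<Longrightarrow> exp (\<beta> n * A n \<omega>) \<le> Z n \<omega> \<and> Z n \<omega> \<le> \<kappa> n * exp (\<beta> n * A n \<omega>)"
    and WY: "\<And>n \<omega>. \<omega> \<in> space N \<Longrightarrow> exp (\<beta> n * Yn n \<omega>) \<le> W n \<omega> \<and> W n \<omega> \<le> \<kappa> n * exp (\<beta> n * Yn n \<omega>)"
    and Yn: "\<And>\<omega>. \<omega> \<in> space N \<Longrightarrow> (\<lambda>n. Yn n \<omega>) \<longlonglongrightarrow> Y \<omega>"
    and close: "\<And>x. (\<lambda>n. (\<integral>\<omega>. exp (- (exp (- (\<beta> n * x)) * Z n \<omega>)) \<partial>M)
                      - (\<integral>\<omega>. exp (- (exp (- (\<beta> n * x)) * W n \<omega>)) \<partial>N)) \<longlonglongrightarrow> 0"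
  shows "weak_conv_m (\<lambda>n. distr M borel (A n)) (distr N borel Y)"
proof -
  interpret M: prob_space M by fact
  interpret N: prob_space N by fact
  interpret D: real_distribution "distr N borel Y"
    by (simp add: real_distribution_def real_distribution_axioms_def N.prob_space_distr)
  define hM where "hM n x \<omega> = exp (- (exp (- (\<beta> n * x)) * Z n \<omega>))" for n x \<omega>
  define hN where "hN n x \<omega> = exp (- (exp (- (\<beta> n * x)) * W n \<omega>))" for n x \<omega>
  define F where "F n x = measure M {\<omega> \<in> space M. A n \<omega> \<le> x}" for n x
  define G where "G x = measure N {\<omega> \<in> space N. Y \<omega> \<le> x}" for x
  have cdfF: "cdf (distr M borel (A n)) x = F n x" for n x
    by (simp add: cdf_def measure_distr F_def vimage_def Int_def conj_commute)
  have cdfG: "cdf (distr N borel Y) x = G x" for x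
    by (simp add: cdf_def measure_distr G_def vimage_def Int_def conj_commute)
  have intI: "integrable N (\<lambda>\<omega>. indicator {\<omega> \<in> space N. Y \<omega> \<le> x} \<omega> :: real)" for x
    by (intro integrable_real_indicator) (auto simp: less_top[symmetric])
  have intI': "integrable M (\<lambda>\<omega>. indicator {\<omega> \<in> space M. A n \<omega> \<le> x} \<omega> :: real)" for n x
    by (intro integrable_real_indicator) (auto simp: less_top[symmetric])
  have [measurable]: "hM n x \<in> borel_measurable M" for n x unfolding hM_def by measurable
  have [measurable]: "hN n x \<in> borel_measurable N" for n x unfolding hN_def by measurable
  have hM01: "0 \<le> hM n x \<omega>" "hM n x \<omega> \<le> 1" if "\<omega> \<in> space M" for n x \<omega>
    using ZA[OF that, of n] less_le_trans[OF exp_gt_zero, of "\<beta> n * A n \<omega>" "Z n \<omega>"] by (auto simp: hM_def)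
  have hN01: "0 \<le> hN n x \<omega>" "hN n x \<omega> \<le> 1" if "\<omega> \<in> space N" for n x \<omega>
    using WY[OF that, of n] less_le_trans[OF exp_gt_zero, of "\<beta> n * Yn n \<omega>" "W n \<omega>"] by (auto simp: hN_def)
  have intM: "integrable M (hM n x)" for n x
    by (rule M.integrable_const_bound[of _ 1]) (use hM01 in auto)
  have intN: "integrable N (hN n x)" for n x
    by (rule N.integrable_const_bound[of _ 1]) (use hN01 in auto)
  have upper: "exp (- exp (\<beta> n * (a - x))) \<ge> exp (- (exp (- (\<beta> n * x)) * z))"
    if "exp (\<beta> n * a) \<le> z" for n a x z
    using mult_left_mono[OF that, of "exp (- (\<beta> n * x))"] by (simp add: exp_diff exp_minus field_simps)
  have lower: "exp (- (exp (- (\<beta> n * x)) * z)) \<ge> exp (- (\<kappa> n * exp (\<beta> n * (a - x))))"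
    if "z \<le> \<kappa> n * exp (\<beta> n * a)" for n a x z
    using mult_left_mono[OF that, of "exp (- (\<beta> n * x))"] by (simp add: exp_diff exp_minus field_simps)
  have kap0: "\<kappa> n \<ge> 0" for n
  proof -
    obtain \<omega> where "\<omega> \<in> space M" using M.not_empty by blast
    then have "0 < \<kappa> n * exp (\<beta> n * A n \<omega>)"
      using ZA[of \<omega> n] less_le_trans[OF exp_gt_zero, of "\<beta> n * A n \<omega>" "Z n \<omega>"] by linarith
    then show ?thesis by (simp add: zero_less_mult_iff)
  qed
  have lim1: "(\<lambda>n. exp (- (\<kappa> n * exp (- (\<beta> n * \<delta>))))) \<longlonglongrightarrow> 1" if "\<delta> > 0" for \<delta>
    using tendsto_exp[OF tendsto_minus[OF \<kappa>[OF that]]] by simp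
  have lim0: "(\<lambda>n. exp (- exp (\<beta> n * \<delta>))) \<longlonglongrightarrow> 0" if "\<delta> > 0" for \<delta>
  proof -
    have "filterlim (\<lambda>n. exp (\<beta> n * \<delta>)) at_top sequentially"
      using filterlim_tendsto_pos_mult_at_top[OF tendsto_const that \<beta>]
      by (intro filterlim_compose[OF exp_at_top]) (simp add: mult.commute)
    then show ?thesis
      by (intro filterlim_compose[OF exp_at_bot]) (simp add: filterlim_uminus_at_top[symmetric])
  qed
  have pt1: "(\<lambda>n. hN n x \<omega>) \<longlonglongrightarrow> 1" if \<omega>: "\<omega> \<in> space N" and lt: "Y \<omega> < x" for x \<omega>
  proof -
    define \<delta> where "\<delta> = (x - Y \<omega>) / 2"
    have \<delta>: "\<delta> > 0" "Y \<omega> < x - \<delta>" using lt by (auto simp: \<delta>_def field_simps)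
    show ?thesis
    proof (rule tendsto_sandwich[OF _ _ lim1[OF \<delta>(1)] tendsto_const])
      show "eventually (\<lambda>n. exp (- (\<kappa> n * exp (- (\<beta> n * \<delta>)))) \<le> hN n x \<omega>) sequentially"
        using order_tendstoD(2)[OF Yn[OF \<omega>] \<delta>(2)]
      proof eventually_elim
        case (elim n)
        have "\<beta> n * (Yn n \<omega> - x) \<le> \<beta> n * (- \<delta>)" using elim \<beta>0 by (intro mult_left_mono) auto
        then have "\<kappa> n * exp (\<beta> n * (Yn n \<omega> - x)) \<le> \<kappa> n * exp (- (\<beta> n * \<delta>))"
          using kap0 by (intro mult_left_mono) auto
        then show ?case using lower[of "W n \<omega>" n "Yn n \<omega>" x] WY[OF \<omega>, of n] unfolding hN_def
          by (meson exp_le_cancel_iff neg_le_iff_le order_trans)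
      qed
    qed (use hN01[OF \<omega>] in auto)
  qed
  have pt0: "(\<lambda>n. hN n x \<omega>) \<longlonglongrightarrow> 0" if \<omega>: "\<omega> \<in> space N" and lt: "x < Y \<omega>" for x \<omega>
  proof -
    define \<delta> where "\<delta> = (Y \<omega> - x) / 2"
    have \<delta>: "\<delta> > 0" "x + \<delta> < Y \<omega>" using lt by (auto simp: \<delta>_def field_simps)
    show ?thesis
    proof (rule tendsto_sandwich[OF _ _ tendsto_const lim0[OF \<delta>(1)]])
      show "eventually (\<lambda>n. hN n x \<omega> \<le> exp (- exp (\<beta> n * \<delta>))) sequentially"
        using order_tendstoD(1)[OF Yn[OF \<omega>] \<delta>(2)]
      proof eventually_elim
        case (elim n)
        have "exp (\<beta> n * \<delta>) \<le> exp (\<beta> n * (Yn n \<omega> - x))"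
          unfolding exp_le_cancel_iff using elim \<beta>0 by (intro mult_left_mono) auto
        then show ?case using upper[of n "Yn n \<omega>" "W n \<omega>" x] WY[OF \<omega>, of n] unfolding hN_def
          by (meson exp_le_cancel_iff neg_le_iff_le order_trans)
      qed
    qed (use hN01[OF \<omega>] in auto)
  qed
  \<comment> \<open>Nothing is known about \<open>hN\<close> on the event \<open>Y = x\<close>, which may have positive probability. Taking
    the maximum with the indicator of \<open>Y \<le> x\<close> restores convergence everywhere.\<close>
  have evN_upper: "eventually (\<lambda>n. (\<integral>\<omega>. hN n x \<omega> \<partial>N) < G x + \<epsilon>) sequentially" if "\<epsilon> > 0" for x \<epsilon>
  proof -
    let ?I = "\<lambda>\<omega>. indicator {\<omega> \<in> space N. Y \<omega> \<le> x} \<omega> :: real"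
    have "(\<lambda>n. \<integral>\<omega>. max (hN n x \<omega>) (?I \<omega>) \<partial>N) \<longlonglongrightarrow> (\<integral>\<omega>. ?I \<omega> \<partial>N)"
    proof (rule integral_dominated_convergence[where w = "\<lambda>_. 1"])
      show "AE \<omega> in N. (\<lambda>n. max (hN n x \<omega>) (?I \<omega>)) \<longlonglongrightarrow> ?I \<omega>"
      proof (rule AE_I2)
        fix \<omega> assume \<omega>: "\<omega> \<in> space N"
        show "(\<lambda>n. max (hN n x \<omega>) (?I \<omega>)) \<longlonglongrightarrow> ?I \<omega>"
        proof (cases "Y \<omega> \<le> x")
          case True
          then have "(\<lambda>n. max (hN n x \<omega>) (?I \<omega>)) = (\<lambda>n. 1)"
            using hN01[OF \<omega>] \<omega> by (auto simp: max_def fun_eq_iff intro: order_antisym)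
          then show ?thesis using True \<omega> by simp
        next
          case False
          then show ?thesis
            using tendsto_max[OF pt0[OF \<omega>, of x] tendsto_const[of "0::real"]] by simp
        qed
      qed
      show "AE \<omega> in N. norm (max (hN n x \<omega>) (?I \<omega>)) \<le> 1" for n
        using hN01 by (intro AE_I2) (auto simp: indicator_def max_def)
    qed auto
    also have "(\<integral>\<omega>. ?I \<omega> \<partial>N) = G x" by (simp add: G_def)
    finally have "eventually (\<lambda>n. (\<integral>\<omega>. max (hN n x \<omega>) (?I \<omega>) \<partial>N) < G x + \<epsilon>) sequentially"
      using that by (intro order_tendstoD(2)) auto
    then show ?thesis
    proof eventually_elim
      case (elim n)
      have "(\<integral>\<omega>. hN n x \<omega> \<partial>N) \<le> (\<integral>\<omega>. max (hN n x \<omega>) (?I \<omega>) \<partial>N)"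
        by (intro integral_mono Bochner_Integration.integrable_max intN intI) auto
      then show ?case using elim by linarith
    qed
  qed
  have evN_lower: "eventually (\<lambda>n. (\<integral>\<omega>. hN n x \<omega> \<partial>N) > G y - \<epsilon>) sequentially" if "\<epsilon> > 0" "y < x" for x y \<epsilon>
  proof -
    let ?I = "\<lambda>\<omega>. indicator {\<omega> \<in> space N. Y \<omega> \<le> y} \<omega> :: real"
    have "(\<lambda>n. \<integral>\<omega>. min (hN n x \<omega>) (?I \<omega>) \<partial>N) \<longlonglongrightarrow> (\<integral>\<omega>. ?I \<omega> \<partial>N)"
    proof (rule integral_dominated_convergence[where w = "\<lambda>_. 1"])
      show "AE \<omega> in N. (\<lambda>n. min (hN n x \<omega>) (?I \<omega>)) \<longlonglongrightarrow> ?I \<omega>"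
      proof (rule AE_I2)
        fix \<omega> assume \<omega>: "\<omega> \<in> space N"
        show "(\<lambda>n. min (hN n x \<omega>) (?I \<omega>)) \<longlonglongrightarrow> ?I \<omega>"
        proof (cases "Y \<omega> \<le> y")
          case True
          then show ?thesis
            using tendsto_min[OF pt1[OF \<omega>, of x] tendsto_const[of "1::real"]] \<omega> that by simp
        next
          case False
          then have "(\<lambda>n. min (hN n x \<omega>) (?I \<omega>)) = (\<lambda>n. 0)"
            using hN01[OF \<omega>] \<omega> by (auto simp: min_def fun_eq_iff intro: order_antisym)
          then show ?thesis using False \<omega> by simp
        qed
      qed
      show "AE \<omega> in N. norm (min (hN n x \<omega>) (?I \<omega>)) \<le> 1" for n
        using hN01 by (intro AE_I2) (auto simp: indicator_def min_def)
    qed auto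
    also have "(\<integral>\<omega>. ?I \<omega> \<partial>N) = G y" by (simp add: G_def)
    finally have "eventually (\<lambda>n. (\<integral>\<omega>. min (hN n x \<omega>) (?I \<omega>) \<partial>N) > G y - \<epsilon>) sequentially"
      using that by (intro order_tendstoD(1)) auto
    then show ?thesis
    proof eventually_elim
      case (elim n)
      have "(\<integral>\<omega>. min (hN n x \<omega>) (?I \<omega>) \<partial>N) \<le> (\<integral>\<omega>. hN n x \<omega> \<partial>N)"
        by (intro integral_mono Bochner_Integration.integrable_min intN intI) auto
      then show ?case using elim by linarith
    qed
  qed
  have close': "eventually (\<lambda>n. \<bar>(\<integral>\<omega>. hM n x \<omega> \<partial>M) - (\<integral>\<omega>. hN n x \<omega> \<partial>N)\<bar> < \<epsilon>) sequentially" if "\<epsilon> > 0" for x \<epsilon>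
    using tendstoD[OF close[of x] that] by (simp add: hM_def hN_def)
  have F_le: "F n x \<le> (\<integral>\<omega>. hM n (x + \<delta>) \<omega> \<partial>M) + (1 - exp (- (\<kappa> n * exp (- (\<beta> n * \<delta>)))))"
    if "\<delta> > 0" for n x \<delta>
  proof -
    let ?q = "exp (- (\<kappa> n * exp (- (\<beta> n * \<delta>))))"
    let ?I = "\<lambda>\<omega>. indicator {\<omega> \<in> space M. A n \<omega> \<le> x} \<omega> :: real"
    have q: "0 \<le> 1 - ?q" using kap0[of n] by simp
    have "F n x = (\<integral>\<omega>. ?I \<omega> \<partial>M)" by (simp add: F_def)
    also have "\<dots> \<le> (\<integral>\<omega>. hM n (x + \<delta>) \<omega> + (1 - ?q) \<partial>M)"
    proof (rule integral_mono)
      fix \<omega> assume \<omega>: "\<omega> \<in> space M"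
      show "?I \<omega> \<le> hM n (x + \<delta>) \<omega> + (1 - ?q)"
      proof (cases "A n \<omega> \<le> x")
        case True
        have "\<beta> n * (A n \<omega> - (x + \<delta>)) \<le> \<beta> n * (- \<delta>)" using True \<beta>0 by (intro mult_left_mono) auto
        then have "\<kappa> n * exp (\<beta> n * (A n \<omega> - (x + \<delta>))) \<le> \<kappa> n * exp (- (\<beta> n * \<delta>))"
          using kap0 by (intro mult_left_mono) auto
        then have "?q \<le> hM n (x + \<delta>) \<omega>"
          using lower[of "Z n \<omega>" n "A n \<omega>" "x + \<delta>"] ZA[OF \<omega>, of n] unfolding hM_def
          by (meson exp_le_cancel_iff neg_le_iff_le order_trans)
        then show ?thesis using True \<omega> by simp
      next
        case False
        then show ?thesis using hM01[OF \<omega>, of n "x + \<delta>"] q by simp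
      qed
    qed (use intM intI' in \<open>auto intro!: Bochner_Integration.integrable_add\<close>)
    also have "\<dots> = (\<integral>\<omega>. hM n (x + \<delta>) \<omega> \<partial>M) + (1 - ?q)"
      using intM M.prob_space by simp
    finally show ?thesis .
  qed
  have F_ge: "(\<integral>\<omega>. hM n (x - \<delta>) \<omega> \<partial>M) \<le> F n x + exp (- exp (\<beta> n * \<delta>))"
    if "\<delta> > 0" for n x \<delta>
  proof -
    let ?I = "\<lambda>\<omega>. indicator {\<omega> \<in> space M. A n \<omega> \<le> x} \<omega> :: real"
    have "(\<integral>\<omega>. hM n (x - \<delta>) \<omega> \<partial>M) \<le> (\<integral>\<omega>. ?I \<omega> + exp (- exp (\<beta> n * \<delta>)) \<partial>M)"
    proof (rule integral_mono)
      fix \<omega> assume \<omega>: "\<omega> \<in> space M"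
      show "hM n (x - \<delta>) \<omega> \<le> ?I \<omega> + exp (- exp (\<beta> n * \<delta>))"
      proof (cases "A n \<omega> \<le> x")
        case True
        then show ?thesis using hM01[OF \<omega>, of n "x - \<delta>"] \<omega> by (simp add: add_increasing2)
      next
        case False
        have "exp (\<beta> n * \<delta>) \<le> exp (\<beta> n * (A n \<omega> - (x - \<delta>)))"
          unfolding exp_le_cancel_iff using False \<beta>0 by (intro mult_left_mono) auto
        then have "hM n (x - \<delta>) \<omega> \<le> exp (- exp (\<beta> n * \<delta>))"
          using upper[of n "A n \<omega>" "Z n \<omega>" "x - \<delta>"] ZA[OF \<omega>, of n] unfolding hM_def
          by (meson exp_le_cancel_iff neg_le_iff_le order_trans)
        then show ?thesis using False by simp
      qed
    qed (use intM intI' in \<open>auto intro!: Bochner_Integration.integrable_add\<close>)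
    also have "\<dots> = F n x + exp (- exp (\<beta> n * \<delta>))"
      using M.prob_space intI' by (simp add: F_def)
    finally show ?thesis .
  qed
  have "(\<lambda>n. F n x) \<longlonglongrightarrow> G x" if x: "isCont G x" for x
  proof (rule order_tendstoI)
    fix a assume "G x < a"
    define \<epsilon> where "\<epsilon> = (a - G x) / 4"
    have \<epsilon>: "\<epsilon> > 0" "a - G x = 4 * \<epsilon>" using \<open>G x < a\<close> by (simp_all add: \<epsilon>_def)
    obtain d where d: "d > 0" "\<And>y. dist y x < d \<Longrightarrow> dist (G y) (G x) < \<epsilon>"
      using x \<epsilon>(1) unfolding continuous_at_eps_delta by blast
    define \<delta> where "\<delta> = d / 2"
    have \<delta>: "\<delta> > 0" using d by (simp add: \<delta>_def)
    have G: "G (x + \<delta>) < G x + \<epsilon>" using d(2)[of "x + \<delta>"] d(1) by (auto simp: dist_real_def \<delta>_def)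
    have "eventually (\<lambda>n. 1 - \<epsilon> < exp (- (\<kappa> n * exp (- (\<beta> n * \<delta>))))) sequentially"
      using \<epsilon> by (intro order_tendstoD(1)[OF lim1[OF \<delta>]]) auto
    with evN_upper[OF \<epsilon>(1), of "x + \<delta>"] close'[OF \<epsilon>(1), of "x + \<delta>"]
    show "eventually (\<lambda>n. F n x < a) sequentially"
    proof eventually_elim
      case (elim n)
      then show ?case using F_le[OF \<delta>, of n x] G \<epsilon>(2) by linarith
    qed
  next
    fix a assume "G x > a"
    define \<epsilon> where "\<epsilon> = (G x - a) / 4"
    have \<epsilon>: "\<epsilon> > 0" "G x - a = 4 * \<epsilon>" using \<open>G x > a\<close> by (simp_all add: \<epsilon>_def)
    obtain d where d: "d > 0" "\<And>y. dist y x < d \<Longrightarrow> dist (G y) (G x) < \<epsilon>"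
      using x \<epsilon>(1) unfolding continuous_at_eps_delta by blast
    define \<delta> where "\<delta> = d / 3"
    have \<delta>: "\<delta> > 0" using d by (simp add: \<delta>_def)
    \<comment> \<open>Two shifts: one from \<open>F\<close> to \<open>hM\<close>, and one because the lower bound for \<open>hN\<close> needs a strictly
      smaller argument of \<open>G\<close>.\<close>
    have G: "G (x - 2 * \<delta>) > G x - \<epsilon>" using d(2)[of "x - 2 * \<delta>"] d(1) by (auto simp: dist_real_def \<delta>_def abs_if split: if_splits)
    have "eventually (\<lambda>n. exp (- exp (\<beta> n * \<delta>)) < \<epsilon>) sequentially"
      using \<epsilon> by (intro order_tendstoD(2)[OF lim0[OF \<delta>]]) auto
    moreover have "x - 2 * \<delta> < x - \<delta>" using \<delta> by simp
    note evN_lower[OF \<epsilon>(1) this]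
    moreover note close'[OF \<epsilon>(1), of "x - \<delta>"]
    ultimately show "eventually (\<lambda>n. F n x > a) sequentially"
    proof eventually_elim
      case (elim n)
      then show ?case using F_ge[OF \<delta>, of n x] G \<epsilon>(2) by linarith
    qed
  qed
  then show ?thesis
    unfolding weak_conv_m_def weak_conv_def cdfF cdfG[abs_def] by blast
qed

section \<open>Moments of Brownian increments and of letter indicators\<close>

text \<open>For a centred normal variable the third absolute moment is \<open>2 * sqrt (2 / pi)\<close> times the cube of
  the standard deviation; the factor \<open>sqrt (2 / pi)\<close> is estimated by \<open>1\<close>. In the degenerate case
  both sides vanish.\<close>
lemma gaussian_rv_third_moment:
  assumes N: "prob_space N" and g: "gaussian_rv N Z" and mean: "(\<integral>\<omega>. Z \<omega> \<partial>N) = 0"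
  shows "integrable N Z" and "integrable N (\<lambda>\<omega>. (Z \<omega>)\<^sup>2)" and "integrable N (\<lambda>\<omega>. \<bar>Z \<omega>\<bar> ^ 3)"
    and "(\<integral>\<omega>. \<bar>Z \<omega>\<bar> ^ 3 \<partial>N) \<le> 2 * sqrt (\<integral>\<omega>. (Z \<omega>)\<^sup>2 \<partial>N) ^ 3"
proof -
  interpret prob_space N by fact
  have Z [measurable]: "Z \<in> borel_measurable N" using g by (simp add: gaussian_rv_def)
  consider (const) \<mu> where "AE \<omega> in N. Z \<omega> = \<mu>"
    | (normal) \<mu> \<sigma> where "\<sigma> > 0" "distributed N lborel Z (normal_density \<mu> \<sigma>)"
    using g unfolding gaussian_rv_def by blast
  then have "integrable N Z \<and> integrable N (\<lambda>\<omega>. (Z \<omega>)\<^sup>2) \<and> integrable N (\<lambda>\<omega>. \<bar>Z \<omega>\<bar> ^ 3)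
    \<and> (\<integral>\<omega>. \<bar>Z \<omega>\<bar> ^ 3 \<partial>N) \<le> 2 * sqrt (\<integral>\<omega>. (Z \<omega>)\<^sup>2 \<partial>N) ^ 3"
  proof cases
    case const
    have "(\<integral>\<omega>. Z \<omega> \<partial>N) = (\<integral>\<omega>. \<mu> \<partial>N)" using const by (intro integral_cong_AE) auto
    then have Z0: "AE \<omega> in N. Z \<omega> = 0" using const mean prob_space by simp
    have i: "integrable N (\<lambda>\<omega>. f (Z \<omega>)) \<and> (\<integral>\<omega>. f (Z \<omega>) \<partial>N) = 0"
      if "f \<in> borel_measurable borel" "f 0 = 0" for f :: "real \<Rightarrow> real"
    proof -
      have ae: "AE \<omega> in N. f (Z \<omega>) = 0" using Z0 by eventually_elim (simp add: that)
      have m: "(\<lambda>\<omega>. f (Z \<omega>)) \<in> borel_measurable N" using that by measurable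
      show ?thesis
        using integrable_cong_AE[OF m _ ae] integral_cong_AE[OF m _ ae] by simp
    qed
    show ?thesis using i[of "\<lambda>x. x"] i[of "\<lambda>x. x\<^sup>2"] i[of "\<lambda>x. \<bar>x\<bar> ^ 3"] by simp
  next
    case normal
    have "\<mu> = 0" using normal_distributed_expectation[OF normal] mean by simp
    then have d: "distributed N lborel Z (normal_density 0 \<sigma>)" using normal(2) by simp
    have tr: "integrable N (\<lambda>\<omega>. f (Z \<omega>)) \<and> (\<integral>\<omega>. f (Z \<omega>) \<partial>N) = a"
      if "has_bochner_integral lborel (\<lambda>x. normal_density 0 \<sigma> x * f x) a" "f \<in> borel_measurable borel"
      for f :: "real \<Rightarrow> real" and a
      using that distributed_integrable[OF d, of f] distributed_integral[OF d, of f]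
      by (simp add: has_bochner_integral_iff)
    have 1: "integrable N Z"
      using tr[of "\<lambda>x. x" 0] normal_moment_odd[OF normal(1), of 0 0] by simp
    have 2: "integrable N (\<lambda>\<omega>. (Z \<omega>)\<^sup>2) \<and> (\<integral>\<omega>. (Z \<omega>)\<^sup>2 \<partial>N) = \<sigma>\<^sup>2"
      using tr[of "\<lambda>x. x\<^sup>2" "\<sigma>\<^sup>2"] normal_moment_even[OF normal(1), of 0 1] normal(1) by simp
    have 3: "integrable N (\<lambda>\<omega>. \<bar>Z \<omega>\<bar> ^ 3) \<and> (\<integral>\<omega>. \<bar>Z \<omega>\<bar> ^ 3 \<partial>N) = 2 * \<sigma> ^ 3 * sqrt (2 / pi)"
      using tr[of "\<lambda>x. \<bar>x\<bar> ^ 3" "2 * \<sigma> ^ 3 * sqrt (2 / pi)"] normal_moment_abs_odd[OF normal(1), of 0 1]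
      by (simp add: eval_nat_numeral)
    have "sqrt (2 / pi) \<le> 1" using pi_ge_two by simp
    then have "2 * \<sigma> ^ 3 * sqrt (2 / pi) \<le> 2 * \<sigma> ^ 3" using normal(1) by (intro mult_left_le) auto
    then show ?thesis using 1 2 3 normal(1) by simp
  qed
  then show "integrable N Z" "integrable N (\<lambda>\<omega>. (Z \<omega>)\<^sup>2)" "integrable N (\<lambda>\<omega>. \<bar>Z \<omega>\<bar> ^ 3)"
    "(\<integral>\<omega>. \<bar>Z \<omega>\<bar> ^ 3 \<partial>N) \<le> 2 * sqrt (\<integral>\<omega>. (Z \<omega>)\<^sup>2 \<partial>N) ^ 3" by auto
qed

lemma brownian_motion_gaussian:
  assumes B: "brownian_motion N d C B" and i: "i \<in> {1..d}" and t: "t \<in> {0..1}"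
  shows "gaussian_rv N (B i t)"
proof -
  have "gaussian_process N ({1..d} \<times> {0..1}) (\<lambda>(i, t). B i t)"
    using B by (simp add: brownian_motion_def)
  from this[unfolded gaussian_process_def, rule_format, of "{(i, t)}" "\<lambda>_. 1"] i t
  show ?thesis by simp
qed

lemma brownian_motion_moments:
  assumes B: "brownian_motion N d C B" and i: "i \<in> {1..d}" and t: "t \<in> {0..1}"
  shows "(\<integral>\<omega>. B i t \<omega> \<partial>N) = 0"
    and "integrable N (\<lambda>\<omega>. \<bar>B i t \<omega>\<bar> ^ 3)"
    and "(\<integral>\<omega>. \<bar>B i t \<omega>\<bar> ^ 3 \<partial>N) \<le> 2 * sqrt (t * C i i) ^ 3"
    and "B i t \<in> borel_measurable N"
    and "j \<in> {1..d} \<Longrightarrow> integrable N (\<lambda>\<omega>. B i t \<omega> * B j t \<omega>)"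
    and "j \<in> {1..d} \<Longrightarrow> (\<integral>\<omega>. B i t \<omega> * B j t \<omega> \<partial>N) = t * C i j"
proof -
  have N: "prob_space N" using B by (simp add: brownian_motion_def)
  have mean: "(\<integral>\<omega>. B i t \<omega> \<partial>N) = 0" if "i \<in> {1..d}" for i
    using B that t by (simp add: brownian_motion_def)
  note g = gaussian_rv_third_moment[OF N brownian_motion_gaussian[OF B _ t] mean]
  have cov: "(\<integral>\<omega>. B i t \<omega> * B j t \<omega> \<partial>N) = t * C i j" if "i \<in> {1..d}" "j \<in> {1..d}" for i j
  proof -
    have "covariance N (B i t) (B j t) = t * C i j"
      using B that t by (simp add: brownian_motion_def)
    then show ?thesis using that by (simp add: covariance_def mean)
  qed
  show "(\<integral>\<omega>. B i t \<omega> \<partial>N) = 0" "integrable N (\<lambda>\<omega>. \<bar>B i t \<omega>\<bar> ^ 3)"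
    using mean g i by auto
  show "(\<integral>\<omega>. \<bar>B i t \<omega>\<bar> ^ 3 \<partial>N) \<le> 2 * sqrt (t * C i i) ^ 3"
    using g(4)[OF i i] cov[OF i i] by (simp add: power2_eq_square)
  have meas: "B i t \<in> borel_measurable N" if "i \<in> {1..d}" for i
    using g(1)[OF that that] by blast
  then show "B i t \<in> borel_measurable N" using i by blast
  assume j: "j \<in> {1..d}"
  show "(\<integral>\<omega>. B i t \<omega> * B j t \<omega> \<partial>N) = t * C i j" by (rule cov[OF i j])
  show "integrable N (\<lambda>\<omega>. B i t \<omega> * B j t \<omega>)"
  proof (rule Bochner_Integration.integrable_bound[of _ "\<lambda>\<omega>. (B i t \<omega>)\<^sup>2 + (B j t \<omega>)\<^sup>2"])
    have "\<bar>u * v\<bar> \<le> \<bar>u\<^sup>2 + v\<^sup>2\<bar>" for u v :: real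
    proof -
      have "2 * \<bar>u\<bar> * \<bar>v\<bar> \<le> u\<^sup>2 + v\<^sup>2" using sum_squares_bound[of "\<bar>u\<bar>" "\<bar>v\<bar>"] by simp
      then show ?thesis using abs_ge_zero[of "u * v"] unfolding abs_mult by linarith
    qed
    then show "AE \<omega> in N. norm (B i t \<omega> * B j t \<omega>) \<le> norm ((B i t \<omega>)\<^sup>2 + (B j t \<omega>)\<^sup>2)"
      by (intro AE_I2) (simp only: real_norm_def)
  qed (use g(2) i j meas in auto)
qed

text \<open>At a fixed time the sum of the coordinates has second moment \<open>t\<close> times the sum of the entries of
  \<open>C\<close>, hence it vanishes almost surely. This holds simultaneously at the countably many times \<open>k/n\<close>,
  and each time is a limit of such times.\<close>
lemma brownian_motion_sum_zero:
  assumes B: "brownian_motion N d C B" and C: "(\<Sum>i=1..d. \<Sum>j=1..d. C i j) = 0"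
  shows "AE \<omega> in N. \<forall>t\<in>{0..1}. (\<Sum>i=1..d. B i t \<omega>) = 0"
proof -
  have fixed: "AE \<omega> in N. (\<Sum>i=1..d. B i t \<omega>) = 0" if t: "t \<in> {0..1}" for t
  proof -
    note bm = brownian_motion_moments[OF B _ t]
    have sq: "(\<Sum>i=1..d. B i t \<omega>)\<^sup>2 = (\<Sum>i=1..d. \<Sum>j=1..d. B i t \<omega> * B j t \<omega>)" for \<omega>
      by (simp add: power2_eq_square sum_product)
    have int: "integrable N (\<lambda>\<omega>. (\<Sum>i=1..d. B i t \<omega>)\<^sup>2)"
      unfolding sq by (intro Bochner_Integration.integrable_sum bm(5))
    have "(\<integral>\<omega>. (\<Sum>i=1..d. B i t \<omega>)\<^sup>2 \<partial>N) = (\<Sum>i=1..d. \<Sum>j=1..d. \<integral>\<omega>. B i t \<omega> * B j t \<omega> \<partial>N)"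
      unfolding sq
      by (rule has_bochner_integral_integral_eq)
        (intro has_bochner_integral_sum has_bochner_integral_integrable bm(5))
    also have "\<dots> = (\<Sum>i=1..d. \<Sum>j=1..d. t * C i j)"
      by (intro sum.cong refl bm(6))
    also have "\<dots> = t * (\<Sum>i=1..d. \<Sum>j=1..d. C i j)" by (simp add: sum_distrib_left)
    finally have "(\<integral>\<omega>. (\<Sum>i=1..d. B i t \<omega>)\<^sup>2 \<partial>N) = 0" using C by simp
    then have "AE \<omega> in N. (\<Sum>i=1..d. B i t \<omega>)\<^sup>2 = 0"
      by (subst (asm) integral_nonneg_eq_0_iff_AE[OF int]) auto
    then show ?thesis by simp
  qed
  have "AE \<omega> in N. \<forall>n k. k \<le> n \<longrightarrow> (\<Sum>i=1..d. B i (real k / real n) \<omega>) = 0"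
    unfolding AE_all_countable
  proof (intro allI)
    fix n k :: nat
    show "AE \<omega> in N. k \<le> n \<longrightarrow> (\<Sum>i=1..d. B i (real k / real n) \<omega>) = 0"
      using fixed[of "real k / real n"] by (cases "k \<le> n") (auto simp: divide_le_eq_1)
  qed
  moreover have "AE \<omega> in N. \<omega> \<in> space N" by simp
  ultimately show ?thesis
  proof eventually_elim
    case (elim \<omega>)
    show ?case
    proof
      fix t :: real assume t: "t \<in> {0..1}"
      let ?k = "\<lambda>n. nat \<lfloor>real n * t\<rfloor>"
      have k: "?k n \<le> n" for n
      proof -
        have "real n * t \<le> real n" using t by (simp add: mult_left_le)
        then show ?thesis by linarith
      qed
      have "(\<lambda>n. \<Sum>i=1..d. B i (real (?k n) / real n) \<omega>) \<longlonglongrightarrow> (\<Sum>i=1..d. B i t \<omega>)"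
      proof (rule tendsto_sum)
        fix i assume "i \<in> {1..d}"
        then have "continuous_on {0..1} (\<lambda>t. B i t \<omega>)"
          using B elim by (simp add: brownian_motion_def)
        then show "(\<lambda>n. B i (real (?k n) / real n) \<omega>) \<longlonglongrightarrow> B i t \<omega>"
        proof (rule continuous_on_tendsto_compose)
          have "real j / real n \<in> {0..1}" if "j \<le> n" for j n
            using that by (auto simp: divide_le_eq_1)
          then show "eventually (\<lambda>n. real (?k n) / real n \<in> {0..1}) sequentially"
            using k by (intro always_eventually allI) blast
        qed (use t nat_floor_ratio_tendsto[of t] in auto)
      qed
      moreover have "(\<lambda>n. \<Sum>i=1..d. B i (real (?k n) / real n) \<omega>) = (\<lambda>n. 0)"
        using elim k by auto
      ultimately show "(\<Sum>i=1..d. B i t \<omega>) = 0"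
        using LIMSEQ_unique tendsto_const by metis
    qed
  qed
qed

lemma centered_vector_law_distr:
  fixes V :: "'b \<Rightarrow> nat \<Rightarrow> real"
  assumes N: "prob_space N" and V: "V \<in> measurable N (\<Pi>\<^sub>M r\<in>{1..m}. borel)"
    and "\<And>r. r \<in> {1..m} \<Longrightarrow> integrable N (\<lambda>\<omega>. \<bar>V \<omega> r\<bar> ^ 3)"
    and "\<And>r. r \<in> {1..m} \<Longrightarrow> (\<integral>\<omega>. \<bar>V \<omega> r\<bar> ^ 3 \<partial>N) \<le> \<tau>"
    and "\<And>r. r \<in> {1..m} \<Longrightarrow> (\<integral>\<omega>. V \<omega> r \<partial>N) = 0"
    and "\<And>r s. r \<in> {1..m} \<Longrightarrow> s \<in> {1..m} \<Longrightarrow> (\<integral>\<omega>. V \<omega> r * V \<omega> s \<partial>N) = C r s"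
  shows "centered_vector_law m C \<tau> (distr N (\<Pi>\<^sub>M r\<in>{1..m}. borel) V)"
proof -
  have comp: "(\<lambda>y. y r) \<in> borel_measurable (\<Pi>\<^sub>M r\<in>{1..m}. (borel :: real measure))" if "r \<in> {1..m}" for r
    using that by (rule measurable_component_singleton)
  have cube: "(\<lambda>y. \<bar>y r\<bar> ^ 3) \<in> borel_measurable (\<Pi>\<^sub>M r\<in>{1..m}. (borel :: real measure))" if "r \<in> {1..m}" for r
    by (intro borel_measurable_power borel_measurable_abs comp that)
  have prod: "(\<lambda>y. y r * y s) \<in> borel_measurable (\<Pi>\<^sub>M r\<in>{1..m}. (borel :: real measure))"
    if "r \<in> {1..m}" "s \<in> {1..m}" for r s
    by (intro borel_measurable_times comp that)
  show ?thesis
    unfolding centered_vector_law_def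
  proof (intro conjI ballI)
    fix r assume r: "r \<in> {1..m}"
    show "integrable (distr N (\<Pi>\<^sub>M r\<in>{1..m}. borel) V) (\<lambda>y. \<bar>y r\<bar> ^ 3)"
      "(\<integral>y. \<bar>y r\<bar> ^ 3 \<partial>distr N (\<Pi>\<^sub>M r\<in>{1..m}. borel) V) \<le> \<tau>"
      "(\<integral>y. y r \<partial>distr N (\<Pi>\<^sub>M r\<in>{1..m}. borel) V) = 0"
      unfolding integrable_distr_eq[OF V cube[OF r]] integral_distr[OF V cube[OF r]]
        integral_distr[OF V comp[OF r]] by (intro assms r)+
    fix s assume s: "s \<in> {1..m}"
    show "(\<integral>y. y r * y s \<partial>distr N (\<Pi>\<^sub>M r\<in>{1..m}. borel) V) = C r s"
      unfolding integral_distr[OF V prod[OF r s]] by (intro assms r s)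
  qed (use N V in \<open>simp_all add: prob_space.prob_space_distr\<close>)
qed

lemma measurable_increment:
  assumes B: "brownian_motion N d C B" and "s \<in> {0..1}" "t \<in> {0..1}"
  shows "increment d B s t \<in> measurable N (\<Pi>\<^sub>M i\<in>{1..d}. borel)"
  unfolding increment_def
  using brownian_motion_moments(4)[OF B] assms by (intro measurable_restrict borel_measurable_diff) auto

text \<open>By stationarity all increments over intervals of length \<open>1/n\<close> share the law of the first one,
  which almost surely is the value at time \<open>1/n\<close>. This reduces all moments to those of the Gaussian
  vector at that single time.\<close>
lemma scaled_increment_law:
  assumes B: "brownian_motion N m C B" and n: "n \<ge> 1" and s: "0 \<le> s" "s \<le> 1"
    and C1: "\<And>i. i \<in> {1..m} \<Longrightarrow> 0 \<le> C i i \<and> C i i \<le> 1"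
  defines "V \<equiv> \<lambda>k \<omega>. \<lambda>r\<in>{1..m}. s * increment m B (real (k - 1) / real n) (real k / real n) \<omega> r"
  shows "prob_space.indep_vars N (\<lambda>_. \<Pi>\<^sub>M r\<in>{1..m}. borel) V {1..n}"
    and "\<And>k. k \<in> {1..n} \<Longrightarrow> distr N (\<Pi>\<^sub>M r\<in>{1..m}. borel) (V k) = distr N (\<Pi>\<^sub>M r\<in>{1..m}. borel) (V 1)"
    and "centered_vector_law m (\<lambda>r q. s\<^sup>2 / real n * C r q) (2 / sqrt (real n) ^ 3) (distr N (\<Pi>\<^sub>M r\<in>{1..m}. borel) (V 1))"
proof -
  let ?P = "\<Pi>\<^sub>M r\<in>{1..m}. (borel :: real measure)"
  interpret N: prob_space N using B by (simp add: brownian_motion_def)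
  let ?sc = "\<lambda>v. \<lambda>r\<in>{1..m}. s * v r :: real"
  have sc: "?sc \<in> measurable ?P ?P"
    by (intro measurable_restrict borel_measurable_times measurable_component_singleton) auto
  have rng: "real k / real n \<in> {0..1}" if "k \<le> n" for k
    using that by (auto simp: divide_le_eq_1)
  have inc: "increment m B (real (k - 1) / real n) (real k / real n) \<in> measurable N ?P" if "k \<in> {1..n}" for k
    using that by (intro measurable_increment[OF B] rng) auto
  have V_eq: "V k = (\<lambda>\<omega>. ?sc (increment m B (real (k - 1) / real n) (real k / real n) \<omega>))" for k
    by (simp add: V_def)
  have "mono_on {0..n} (\<lambda>j. real j / real n)"
    by (auto intro!: mono_onI divide_right_mono)
  then have "N.indep_vars (\<lambda>_. ?P) (\<lambda>j. increment m B (real (j - 1) / real n) (real j / real n)) {1..n}"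
    using B n unfolding brownian_motion_def by (elim conjE) (drule spec[of _ n], drule spec[of _ "\<lambda>j. real j / real n"], auto)
  then show "N.indep_vars (\<lambda>_. ?P) V {1..n}"
    unfolding V_eq[abs_def] by (rule N.indep_vars_compose2) (rule sc)
  show "distr N ?P (V k) = distr N ?P (V 1)" if k: "k \<in> {1..n}" for k
  proof -
    have st: "distr N ?P (increment m B a b) = distr N ?P (increment m B 0 (b - a))"
      if "0 \<le> a" "a \<le> b" "b \<le> 1" for a b
      using B that unfolding brownian_motion_def by blast
    have "distr N ?P (increment m B (real (k - 1) / real n) (real k / real n))
        = distr N ?P (increment m B 0 (real k / real n - real (k - 1) / real n))"
      using k rng[of k] by (intro st) (auto intro!: divide_right_mono)
    also have "real k / real n - real (k - 1) / real n = 1 / real n"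
      using k by (simp add: diff_divide_distrib[symmetric] of_nat_diff)
    finally have d: "distr N ?P (increment m B (real (k - 1) / real n) (real k / real n))
        = distr N ?P (increment m B (real (1 - 1) / real n) (real 1 / real n))" by simp
    have "distr N ?P (V k) = distr (distr N ?P (increment m B (real (k - 1) / real n) (real k / real n))) ?P ?sc"
      using distr_distr[OF sc inc[OF k]] by (simp add: V_eq comp_def)
    also have "\<dots> = distr (distr N ?P (increment m B (real (1 - 1) / real n) (real 1 / real n))) ?P ?sc"
      unfolding d ..
    also have "\<dots> = distr N ?P (V 1)"
      using distr_distr[OF sc inc[of 1]] n by (simp add: V_eq comp_def)
    finally show ?thesis .
  qed
  have Vm: "V 1 \<in> measurable N ?P"
    unfolding V_eq using n by (intro measurable_compose[OF inc sc]) auto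
  have h1: "1 / real n \<in> {0..1}" using n by auto
  note bm = brownian_motion_moments[OF B _ h1]
  have ae: "AE \<omega> in N. V 1 \<omega> r = s * B r (1 / real n) \<omega>" if "r \<in> {1..m}" for r
  proof -
    have "AE \<omega> in N. B r 0 \<omega> = 0" using B that by (simp add: brownian_motion_def)
    then show ?thesis by eventually_elim (use that in \<open>simp add: V_def increment_def\<close>)
  qed
  have Vr[measurable]: "(\<lambda>\<omega>. V 1 \<omega> r) \<in> borel_measurable N" if "r \<in> {1..m}" for r
    using measurable_compose[OF Vm measurable_component_singleton[OF that]] .
  have tau: "s ^ 3 * (2 * sqrt (1 / real n * C r r) ^ 3) \<le> 2 / sqrt (real n) ^ 3" if "r \<in> {1..m}" for r
  proof -
    have "sqrt (1 / real n * C r r) \<le> sqrt (1 / real n)"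
      using C1[OF that] n by (intro real_sqrt_le_mono mult_left_le) auto
    then have "2 * sqrt (1 / real n * C r r) ^ 3 \<le> 2 * sqrt (1 / real n) ^ 3"
      using C1[OF that] by (intro mult_left_mono power_mono) auto
    moreover have "s ^ 3 \<le> 1" using s by (intro power_le_one) auto
    ultimately have "s ^ 3 * (2 * sqrt (1 / real n * C r r) ^ 3) \<le> 1 * (2 * sqrt (1 / real n) ^ 3)"
      using C1[OF that] s by (intro mult_mono) auto
    then show ?thesis by (simp add: real_sqrt_divide power_divide)
  qed
  show "centered_vector_law m (\<lambda>r q. s\<^sup>2 / real n * C r q) (2 / sqrt (real n) ^ 3) (distr N ?P (V 1))"
  proof (rule centered_vector_law_distr[OF N.prob_space_axioms Vm])
    fix r assume r: "r \<in> {1..m}"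
    note [measurable] = bm(4)[OF r]
    have ae3: "AE \<omega> in N. \<bar>V 1 \<omega> r\<bar> ^ 3 = s ^ 3 * \<bar>B r (1 / real n) \<omega>\<bar> ^ 3"
      using ae[OF r] by eventually_elim (use s in \<open>simp add: abs_mult power_mult_distrib\<close>)
    show "integrable N (\<lambda>\<omega>. \<bar>V 1 \<omega> r\<bar> ^ 3)"
      using bm(2)[OF r] by (subst integrable_cong_AE[OF _ _ ae3]) (use Vr[OF r] in auto)
    have "(\<integral>\<omega>. \<bar>V 1 \<omega> r\<bar> ^ 3 \<partial>N) = (\<integral>\<omega>. s ^ 3 * \<bar>B r (1 / real n) \<omega>\<bar> ^ 3 \<partial>N)"
      using Vr[OF r] by (intro integral_cong_AE ae3) auto
    also have "\<dots> = s ^ 3 * (\<integral>\<omega>. \<bar>B r (1 / real n) \<omega>\<bar> ^ 3 \<partial>N)" by simp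
    also have "\<dots> \<le> s ^ 3 * (2 * sqrt (1 / real n * C r r) ^ 3)"
      using s by (intro mult_left_mono bm(3)[OF r]) auto
    also note tau[OF r]
    finally show "(\<integral>\<omega>. \<bar>V 1 \<omega> r\<bar> ^ 3 \<partial>N) \<le> 2 / sqrt (real n) ^ 3" .
    have "(\<integral>\<omega>. V 1 \<omega> r \<partial>N) = (\<integral>\<omega>. s * B r (1 / real n) \<omega> \<partial>N)"
      using Vr[OF r] by (intro integral_cong_AE ae[OF r]) auto
    then show "(\<integral>\<omega>. V 1 \<omega> r \<partial>N) = 0" using bm(1)[OF r] by simp
    fix q assume q: "q \<in> {1..m}"
    note [measurable] = bm(4)[OF q]
    have "(\<integral>\<omega>. V 1 \<omega> r * V 1 \<omega> q \<partial>N) = (\<integral>\<omega>. s\<^sup>2 * (B r (1 / real n) \<omega> * B q (1 / real n) \<omega>) \<partial>N)"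
    proof (rule integral_cong_AE)
      show "AE \<omega> in N. V 1 \<omega> r * V 1 \<omega> q = s\<^sup>2 * (B r (1 / real n) \<omega> * B q (1 / real n) \<omega>)"
        using ae[OF r] ae[OF q] by eventually_elim (simp add: power2_eq_square)
    qed (use Vr[OF r] Vr[OF q] in auto)
    then show "(\<integral>\<omega>. V 1 \<omega> r * V 1 \<omega> q \<partial>N) = s\<^sup>2 / real n * C r q"
      using bm(6)[OF r q] by simp
  qed
qed

text \<open>The indicators of the letters are orthogonal idempotents, which gives the covariance
  \<open>of_bool (r = q) / m - 1 / m\<^sup>2\<close> of one letter, that is \<open>1/m\<close> times the covariance matrix of the
  Brownian motion in the limit theorem. Third moments are bounded trivially, as the centred
  indicators are at most \<open>1\<close> in absolute value.\<close>
lemma uniform_letter_law: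
  fixes \<xi> :: "'a \<Rightarrow> 'c" and n :: nat
  assumes M: "prob_space M" and m: "m \<ge> 1" and inj: "inj_on \<alpha> {1..m}"
    and X: "\<xi> \<in> measurable M (count_space (\<alpha> ` {1..m}))"
    and unif: "\<And>r. r \<in> {1..m} \<Longrightarrow> measure M {\<omega> \<in> space M. \<xi> \<omega> = \<alpha> r} = 1 / real m"
  defines "U \<equiv> \<lambda>\<omega>. \<lambda>r\<in>{1..m}. (of_bool (\<xi> \<omega> = \<alpha> r) - 1 / real m) * (1 / sqrt (real n))"
  shows "centered_vector_law m (\<lambda>r q. (of_bool (r = q) / real m - 1 / real m ^ 2) / real n) (2 / sqrt (real n) ^ 3)
    (distr M (\<Pi>\<^sub>M r\<in>{1..m}. borel) U)"
proof -
  let ?P = "\<Pi>\<^sub>M r\<in>{1..m}. (borel :: real measure)"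
  interpret prob_space M by fact
  define e where "e r \<omega> = (of_bool (\<xi> \<omega> = \<alpha> r) :: real)" for r \<omega>
  have e_meas[measurable]: "e r \<in> borel_measurable M" for r
    unfolding e_def using measurable_compose[OF X, of "\<lambda>x. of_bool (x = \<alpha> r) :: real" borel] by simp
  have e_int: "integrable M (e r)" for r
    by (rule integrable_const_bound[of _ 1]) (auto simp: e_def)
  have Ee: "(\<integral>\<omega>. e r \<omega> \<partial>M) = 1 / real m" if "r \<in> {1..m}" for r
  proof -
    have "(\<integral>\<omega>. e r \<omega> \<partial>M) = (\<integral>\<omega>. indicator {\<omega> \<in> space M. \<xi> \<omega> = \<alpha> r} \<omega> \<partial>M)"
      by (intro Bochner_Integration.integral_cong) (auto simp: e_def)
    also have "\<dots> = measure M ({\<omega> \<in> space M. \<xi> \<omega> = \<alpha> r} \<inter> space M)" by simp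
    also have "{\<omega> \<in> space M. \<xi> \<omega> = \<alpha> r} \<inter> space M = {\<omega> \<in> space M. \<xi> \<omega> = \<alpha> r}" by blast
    also note unif[OF that]
    finally show ?thesis .
  qed
  have ee: "e r \<omega> * e q \<omega> = of_bool (r = q) * e r \<omega>" if "r \<in> {1..m}" "q \<in> {1..m}" for r q \<omega>
    using inj_onD[OF inj _ that] by (auto simp: e_def)
  have U: "U \<omega> r = (e r \<omega> - 1 / real m) * (1 / sqrt (real n))" if "r \<in> {1..m}" for r \<omega>
    using that by (simp add: U_def e_def)
  have Um: "U \<in> measurable M ?P"
    unfolding U_def e_def[symmetric] by measurable
  have cube: "\<bar>U \<omega> r\<bar> ^ 3 \<le> 2 / sqrt (real n) ^ 3" if "r \<in> {1..m}" for r \<omega>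
  proof -
    have "\<bar>e r \<omega> - 1 / real m\<bar> \<le> 1" using m by (auto simp: e_def)
    then have "\<bar>e r \<omega> - 1 / real m\<bar> * (1 / sqrt (real n)) \<le> 1 * (1 / sqrt (real n))"
      by (intro mult_right_mono) auto
    then have "\<bar>U \<omega> r\<bar> \<le> 1 / sqrt (real n)" by (simp add: U[OF that] abs_mult)
    then have "\<bar>U \<omega> r\<bar> ^ 3 \<le> (1 / sqrt (real n)) ^ 3" by (intro power_mono) auto
    also have "\<dots> \<le> 2 / sqrt (real n) ^ 3" by (simp add: power_divide divide_right_mono)
    finally show ?thesis .
  qed
  have Ur: "(\<lambda>\<omega>. U \<omega> r) \<in> borel_measurable M" if "r \<in> {1..m}" for r
    using measurable_compose[OF Um measurable_component_singleton[OF that]] .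
  show ?thesis
  proof (rule centered_vector_law_distr[OF M Um])
    fix r assume r: "r \<in> {1..m}"
    show int: "integrable M (\<lambda>\<omega>. \<bar>U \<omega> r\<bar> ^ 3)"
      by (rule integrable_const_bound[of _ "2 / sqrt (real n) ^ 3"]) (use cube[OF r] Ur[OF r] in auto)
    have "(\<integral>\<omega>. \<bar>U \<omega> r\<bar> ^ 3 \<partial>M) \<le> (\<integral>\<omega>. 2 / sqrt (real n) ^ 3 \<partial>M)"
      by (intro integral_mono int cube[OF r]) auto
    then show "(\<integral>\<omega>. \<bar>U \<omega> r\<bar> ^ 3 \<partial>M) \<le> 2 / sqrt (real n) ^ 3" by (simp add: prob_space)
    show "(\<integral>\<omega>. U \<omega> r \<partial>M) = 0"
      using e_int by (simp add: U[OF r] Ee[OF r] prob_space)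
    fix q assume q: "q \<in> {1..m}"
    have "U \<omega> r * U \<omega> q = (of_bool (r = q) * e r \<omega> - e r \<omega> / real m - e q \<omega> / real m + 1 / real m ^ 2) / real n" for \<omega>
    proof -
      have "U \<omega> r * U \<omega> q = (e r \<omega> - 1 / real m) * (e q \<omega> - 1 / real m) * (1 / sqrt (real n) * (1 / sqrt (real n)))"
        by (simp add: U[OF r] U[OF q])
      also have "1 / sqrt (real n) * (1 / sqrt (real n)) = 1 / real n" by simp
      finally show ?thesis
        unfolding ee[OF r q, symmetric] by (simp add: algebra_simps power2_eq_square add_divide_distrib diff_divide_distrib)
    qed
    then show "(\<integral>\<omega>. U \<omega> r * U \<omega> q \<partial>M) = (of_bool (r = q) / real m - 1 / real m ^ 2) / real n"
      using e_int by (simp add: Ee[OF r] Ee[OF q] prob_space power2_eq_square)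
  qed
qed


section \<open>The limit law of the longest increasing subsequence\<close>
theorem theorem3p2:
  fixes m :: nat
    and \<alpha> :: "nat \<Rightarrow> 'c::linorder"
    and M :: "'a measure" and X :: "nat \<Rightarrow> 'a \<Rightarrow> 'c"
    and N :: "'b measure" and B :: "nat \<Rightarrow> real \<Rightarrow> 'b \<Rightarrow> real"
  assumes "m \<ge> 2"
    and "strict_mono_on {1..m} \<alpha>"
    and "prob_space M"
    and "prob_space.indep_vars M (\<lambda>_. count_space (\<alpha> ` {1..m})) X {1..}"
    and "\<And>n. n \<ge> 1 \<Longrightarrow>
           distr M (count_space (\<alpha> ` {1..m})) (X n) = distr M (count_space (\<alpha> ` {1..m})) (X 1)"
    and "\<And>r. r \<in> {1..m} \<Longrightarrow> measure M {\<omega> \<in> space M. X 1 \<omega> = \<alpha> r} = 1 / real m"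
    and "brownian_motion N m
           (\<lambda>i j. (real m - 1) / real m * (if i = j then 1 else - 1 / (real m - 1))) B"
  shows "weak_conv_m
           (\<lambda>n. distr M borel
              (\<lambda>\<omega>. (real (longest_increasing (\<lambda>i. X i \<omega>) n) - real n / real m) / sqrt (real n)))
           (distr N borel (\<lambda>\<omega>. 1 / sqrt (real m) * chain_max m (\<lambda>i t. B i t \<omega>)))
         \<and> (AE \<omega> in N. \<forall>t\<in>{0..1}. (\<Sum>i=1..m. B i t \<omega>) = 0)"
proof
  let ?L = "count_space (\<alpha> ` {1..m})" and ?P = "\<Pi>\<^sub>M r\<in>{1..m}. (borel :: real measure)"
  define C where "C i j = (real m - 1) / real m * (if i = j then 1 else - 1 / (real m - 1))" for i j :: nat
  have m: "m \<ge> 1" using assms(1) by simp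
  note \<alpha> = assms(2) and M = assms(3)
  have B: "brownian_motion N m C B" using assms(7) by (simp add: C_def[abs_def])
  interpret M: prob_space M by fact
  interpret N: prob_space N using B by (simp add: brownian_motion_def)
  have C_eq: "C i j = of_bool (i = j) - 1 / real m" for i j
    using assms(1) by (auto simp: C_def field_simps)
  have C0: "(\<Sum>i=1..m. \<Sum>j=1..m. C i j) = 0"
    using m by (simp add: C_eq sum_subtractf)
  show "AE \<omega> in N. \<forall>t\<in>{0..1}. (\<Sum>i=1..m. B i t \<omega>) = 0"
    by (rule brownian_motion_sum_zero[OF B C0])

  define enc where "enc n \<xi> = (\<lambda>r\<in>{1..m}. (of_bool (\<xi> = \<alpha> r) - 1 / real m) * (1 / sqrt (real n)))"
    for n and \<xi> :: 'c
  define U where "U n k \<omega> = enc n (X k \<omega>)" for n k \<omega>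
  define s where "s = 1 / sqrt (real m)"
  define V where "V n k \<omega> = (\<lambda>r\<in>{1..m}. s * increment m B (real (k - 1) / real n) (real k / real n) \<omega> r)" for n k \<omega>
  define A where "A n \<omega> = (real (longest_increasing (\<lambda>i. X i \<omega>) n) - real n / real m) / sqrt (real n)" for n \<omega>
  define Y where "Y \<omega> = 1 / sqrt (real m) * chain_max m (\<lambda>i t. B i t \<omega>)" for \<omega>
  \<comment> \<open>Any power of \<open>n\<close> with exponent strictly between \<open>0\<close> and \<open>1/6\<close> works: the exchange error is of
    order \<open>\<beta> ^ 3 / sqrt n\<close>, and \<open>\<beta>\<close> has to dominate \<open>ln n\<close>.\<close>
  define \<beta> where "\<beta> n = real n powr (1 / 12)" for n :: nat
  have s: "0 \<le> s" "s \<le> 1" "s\<^sup>2 = 1 / real m" using m by (auto simp: s_def power_divide)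

  have X_meas: "X k \<in> measurable M ?L" if "k \<ge> 1" for k
    using assms(4) that by (auto simp: M.indep_vars_def)
  have enc_meas: "enc n \<in> measurable ?L ?P" for n by (auto simp: enc_def space_PiM)
  have U_ind: "M.indep_vars (\<lambda>_. ?P) (U n) {1..n}" for n
  proof -
    have "M.indep_vars (\<lambda>_. ?L) X {1..n}" by (rule M.indep_vars_subset[OF assms(4)]) auto
    then show ?thesis unfolding U_def by (rule M.indep_vars_compose2) (rule enc_meas)
  qed
  have U_law: "distr M ?P (U n k) = distr M ?P (U n 1)" if "k \<in> {1..n}" for n k
  proof -
    have "distr M ?P (U n j) = distr (distr M ?L (X j)) ?P (enc n)" if "j \<ge> 1" for j
      using distr_distr[OF enc_meas X_meas[OF that]] by (simp add: U_def[abs_def] comp_def)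
    then show ?thesis using assms(5)[of k] that by simp
  qed
  have U_cent: "centered_vector_law m (\<lambda>r q. s\<^sup>2 / real n * C r q) (2 / sqrt (real n) ^ 3) (distr M ?P (U n 1))" for n
  proof -
    have "(\<lambda>r q. (of_bool (r = q) / real m - 1 / real m ^ 2) / real n) = (\<lambda>r q. s\<^sup>2 / real n * C r q)"
      by (simp add: C_eq s(3)[unfolded power2_eq_square] fun_eq_iff diff_divide_distrib right_diff_distrib power2_eq_square)
    then show ?thesis
      using uniform_letter_law[OF M m strict_mono_on_imp_inj_on[OF \<alpha>] X_meas[of 1] assms(6), of n]
      by (simp add: U_def[abs_def] enc_def)
  qed
  have C1: "0 \<le> C i i \<and> C i i \<le> 1" for i using m by (simp add: C_eq)
  have V_ind: "N.indep_vars (\<lambda>_. ?P) (V n) {1..n}"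
    and V_law: "\<And>k. k \<in> {1..n} \<Longrightarrow> distr N ?P (V n k) = distr N ?P (V n 1)"
    and V_cent: "centered_vector_law m (\<lambda>r q. s\<^sup>2 / real n * C r q) (2 / sqrt (real n) ^ 3) (distr N ?P (V n 1))"
    if "n \<ge> 1" for n
    using scaled_increment_law[OF B that s(1,2) C1] unfolding V_def[abs_def] by blast+

  have U_max: "A n \<omega> = passage_max m n (\<lambda>k. U n k \<omega>)" if \<omega>: "\<omega> \<in> space M" for n \<omega>
  proof -
    have "X k \<omega> \<in> \<alpha> ` {1..m}" if "k \<in> {1..n}" for k
      using measurable_space[OF X_meas \<omega>, of k] that by simp
    then have "A n \<omega> = (passage_max m n (\<lambda>k r. of_bool (X k \<omega> = \<alpha> r)) - real n * (1 / real m)) * (1 / sqrt (real n))"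
      unfolding A_def using longest_increasing_eq_passage_max[OF m \<alpha>, of n "\<lambda>k. X k \<omega>"] by simp
    also have "\<dots> = passage_max m n (\<lambda>k r. (of_bool (X k \<omega> = \<alpha> r) - 1 / real m) * (1 / sqrt (real n)))"
      by (rule passage_max_center[OF m, symmetric]) simp
    also have "\<dots> = passage_max m n (\<lambda>k. U n k \<omega>)"
      by (rule passage_max_cong) (simp add: U_def enc_def)
    finally show ?thesis .
  qed
  have V_max: "(\<lambda>n. passage_max m n (\<lambda>k. V n k \<omega>)) \<longlonglongrightarrow> Y \<omega>" if \<omega>: "\<omega> \<in> space N" for \<omega>
  proof -
    have "(\<lambda>n. passage_max m n (\<lambda>k r. s * B r (real k / real n) \<omega> - s * B r (real (k - 1) / real n) \<omega>))
      \<longlonglongrightarrow> s * chain_max m (\<lambda>i t. B i t \<omega>)"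
      using B \<omega> by (intro passage_max_path_tendsto m s(1)) (auto simp: brownian_motion_def)
    moreover have "passage_max m n (\<lambda>k r. s * B r (real k / real n) \<omega> - s * B r (real (k - 1) / real n) \<omega>)
      = passage_max m n (\<lambda>k. V n k \<omega>)" for n
      by (rule passage_max_cong) (simp add: V_def increment_def right_diff_distrib)
    ultimately show ?thesis by (simp add: Y_def s_def)
  qed
  \<comment> \<open>The functionals read only the entries \<open>y k r\<close> with \<open>k \<in> {1..n}\<close> and \<open>r \<in> {1..m}\<close>, so they may be
    evaluated at the restriction of the family, which is a point of the product space.\<close>
  have joint: "(\<lambda>\<omega>. f (\<lambda>k. W k \<omega>)) \<in> borel_measurable R"
    if f: "f \<in> borel_measurable (\<Pi>\<^sub>M k\<in>{1..n}. ?P)" and W: "\<And>k. k \<in> {1..n} \<Longrightarrow> W k \<in> measurable R ?P"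
      and cong: "\<And>y z. (\<And>k r. k \<in> {1..n} \<Longrightarrow> r \<in> {1..m} \<Longrightarrow> y k r = z k r) \<Longrightarrow> f y = f z"
    for f :: "(nat \<Rightarrow> nat \<Rightarrow> real) \<Rightarrow> real" and W n and R :: "'r measure"
  proof -
    have "(\<lambda>\<omega>. f (\<lambda>k\<in>{1..n}. W k \<omega>)) \<in> borel_measurable R"
      by (rule measurable_compose[OF measurable_restrict f]) (rule W)
    moreover have "f (\<lambda>k\<in>{1..n}. W k \<omega>) = f (\<lambda>k. W k \<omega>)" for \<omega> by (rule cong) simp
    ultimately show ?thesis by simp
  qed
  have U_meas: "U n k \<in> measurable M ?P" if "k \<in> {1..n}" for n k
    using U_ind[of n] that by (auto simp: M.indep_vars_def)
  have V_meas: "V n k \<in> measurable N ?P" if "k \<in> {1..n}" for n k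
    using V_ind[of n] that by (auto simp: N.indep_vars_def)
  have A_meas: "A n \<in> borel_measurable M" for n
  proof (subst measurable_cong[OF U_max])
    show "(\<lambda>\<omega>. passage_max m n (\<lambda>k. U n k \<omega>)) \<in> borel_measurable M"
      by (rule joint[OF measurable_passage_max U_meas]) (auto intro: passage_max_cong)
  qed
  have Y_meas: "Y \<in> borel_measurable N"
  proof (rule borel_measurable_LIMSEQ_real[OF V_max])
    show "(\<lambda>\<omega>. passage_max m n (\<lambda>k. V n k \<omega>)) \<in> borel_measurable N" for n
      by (rule joint[OF measurable_passage_max V_meas]) (auto intro: passage_max_cong)
  qed
  have "weak_conv_m (\<lambda>n. distr M borel (A n)) (distr N borel Y)"
  proof (rule weak_conv_m_by_soft_indicators[where \<beta> = \<beta> and \<kappa> = "\<lambda>n. (real n + 1) ^ (m + 1)"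
        and Z = "\<lambda>n \<omega>. partition_fun m n (\<beta> n) (\<lambda>k. U n k \<omega>)"
        and W = "\<lambda>n \<omega>. partition_fun m n (\<beta> n) (\<lambda>k. V n k \<omega>)"
        and Yn = "\<lambda>n \<omega>. passage_max m n (\<lambda>k. V n k \<omega>)"])
    show "filterlim \<beta> at_top sequentially" unfolding \<beta>_def by real_asymp
    show "\<beta> n \<ge> 0" for n by (simp add: \<beta>_def)
    show "(\<lambda>n. (real n + 1) ^ (m + 1) * exp (- (\<beta> n * \<delta>))) \<longlonglongrightarrow> 0" if "\<delta> > 0" for \<delta>
      unfolding \<beta>_def using that by real_asymp
    show "(\<lambda>\<omega>. partition_fun m n (\<beta> n) (\<lambda>k. U n k \<omega>)) \<in> borel_measurable M" for n
      by (rule joint[OF measurable_partition_fun U_meas]) (auto intro: partition_fun_cong)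
    show "(\<lambda>\<omega>. partition_fun m n (\<beta> n) (\<lambda>k. V n k \<omega>)) \<in> borel_measurable N" for n
      by (rule joint[OF measurable_partition_fun V_meas]) (auto intro: partition_fun_cong)
    show "exp (\<beta> n * A n \<omega>) \<le> partition_fun m n (\<beta> n) (\<lambda>k. U n k \<omega>) \<and>
        partition_fun m n (\<beta> n) (\<lambda>k. U n k \<omega>) \<le> (real n + 1) ^ (m + 1) * exp (\<beta> n * A n \<omega>)"
      if "\<omega> \<in> space M" for n \<omega>
      using partition_fun_bounds[OF m, of "\<beta> n" n] by (simp add: U_max[OF that] \<beta>_def)
    show "exp (\<beta> n * passage_max m n (\<lambda>k. V n k \<omega>)) \<le> partition_fun m n (\<beta> n) (\<lambda>k. V n k \<omega>) \<and>
        partition_fun m n (\<beta> n) (\<lambda>k. V n k \<omega>)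
          \<le> (real n + 1) ^ (m + 1) * exp (\<beta> n * passage_max m n (\<lambda>k. V n k \<omega>))" for n \<omega>
      using partition_fun_bounds[OF m, of "\<beta> n" n] by (simp add: \<beta>_def)
    fix x
    show "(\<lambda>n. (\<integral>\<omega>. exp (- (exp (- (\<beta> n * x)) * partition_fun m n (\<beta> n) (\<lambda>k. U n k \<omega>))) \<partial>M)
       - (\<integral>\<omega>. exp (- (exp (- (\<beta> n * x)) * partition_fun m n (\<beta> n) (\<lambda>k. V n k \<omega>))) \<partial>N)) \<longlonglongrightarrow> 0"
    proof (rule Lim_null_comparison)
      show "eventually (\<lambda>n. norm ((\<integral>\<omega>. exp (- (exp (- (\<beta> n * x)) * partition_fun m n (\<beta> n) (\<lambda>k. U n k \<omega>))) \<partial>M)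
       - (\<integral>\<omega>. exp (- (exp (- (\<beta> n * x)) * partition_fun m n (\<beta> n) (\<lambda>k. V n k \<omega>))) \<partial>N))
         \<le> real n * (9 * real m ^ 4 * \<beta> n ^ 3 * (2 / sqrt (real n) ^ 3))) sequentially"
        using eventually_ge_at_top[of 1]
      proof eventually_elim
        case (elim n)
        show ?case
          unfolding real_norm_def
          by (rule partition_fun_universality[OF M N.prob_space_axioms elim U_ind V_ind[OF elim]
                U_law V_law[OF elim] U_cent V_cent[OF elim]])
            (simp_all add: \<beta>_def)
      qed
      show "(\<lambda>n. real n * (9 * real m ^ 4 * \<beta> n ^ 3 * (2 / sqrt (real n) ^ 3))) \<longlonglongrightarrow> 0"
        unfolding \<beta>_def by real_asymp
    qed
  qed (use M N.prob_space_axioms A_meas Y_meas V_max in auto)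
  then show "weak_conv_m
           (\<lambda>n. distr M borel
              (\<lambda>\<omega>. (real (longest_increasing (\<lambda>i. X i \<omega>) n) - real n / real m) / sqrt (real n)))
           (distr N borel (\<lambda>\<omega>. 1 / sqrt (real m) * chain_max m (\<lambda>i t. B i t \<omega>)))"
    by (simp add: A_def[abs_def] Y_def[abs_def])
qed

end
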